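(* For every real $\beta>0$ there exists $\alpha>0$ such that the following holds. Whenever $p$ is a prime and $A$ and $B$ are non-empty subsets of $\mathbb{Z}_p$ with $|B| \leq \alpha |A|$ and $|A|+|B| \leq (1-\beta)p$, there exist elements $b_1,b_2,b_3 \in B$ such that $$|A+\{b_1, b_2,b_3\}| \ge |A|+|B|-1.$$
   Context: $\mathbb{Z}_p$ is the cyclic group of prime order $p$. For subsets $X,Y$ of an abelian group, $X+Y=\{x+y : x\in X, y\in Y\}$. The elements $b_1,b_2,b_3$ are not required to be distinct. *)

theory Defs
  imports
    Complex_Main
    "HOL-Algebra.Coset"
    "HOL-Algebra.Elementary_Groups"
    "HOL-Computational_Algebra.Primes"
begin

end

(* For r = |B| - 1 and f(t) = |(A + t) - A|, a pair b, b' in B with f(b - b') >= r already suffices, so assume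
   f < r on B - B. As f is subadditive and its values have mean of order N = min(|A|, p - |A|), far larger than r,
   Cauchy-Davenport shows that at most 5 k r / 2 + 1 shifts satisfy f <= k r. Averaging over frequencies, weighted
   by the squared Fourier transform of A, yields a dilation putting most of B into an interval shorter than p / 50.
   Reducing that part modulo its diameter, the bound on the level sets of f forces a difference set of size below
   3 r / 2, which is then a subgroup; hence f <= 2 r on an arithmetic progression of length about r, and all
   of B lies in a bounded multiple of this progression. After rescaling, B lies in [0, M] with 0, M in B and
   M <= 48 r. Since f = O(r) at all shifts below 7 M, some stretch of 7 M consecutive residues almost misses A, and
   the circle can be cut there. On the line, translates by 0, M and an average b in B add at least r points
   (project modulo M); the few points of A near the cut are paid for by an extra gain inside the stretch. *)

theory Submission
  imports Defs "HOL-Number_Theory.Cong"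
begin

text \<open>The constant \<alpha> is chosen so that A and its complement both have at least
  \<open>C * r\<close> elements for a large \<open>C\<close>. As f is the same for A and its
  complement, its level sets can be bounded through the smaller of the two. The obstacle is that the
  Fourier step sees B only on average: up to a tenth of r elements may lie outside the short
  interval. The structure is therefore built from the other elements, and the rest is caught
  afterwards, since f is small on all of B - B. Both stages play two bounds for one level set
  against each other: Cauchy-Davenport keeps it small, while a wrong configuration would put long
  explicit windows inside it. Constants such as 20, 38, 11 and 16 only have to make these bounds
  collide. The circle is cut because the count modulo M is made for integers, where a shift by M
  never wraps around.\<close>

section \<open>Sets of residues as periodic sets of integers\<close>

text \<open>A set of residues is encoded by its full preimage in the integers, so that shifts
  \<open>x + t\<close> and dilations \<open>e * x\<close> need no reduction and the set can be read
  on any window of the line.\<close>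

definition periodic :: "int \<Rightarrow> int set \<Rightarrow> bool" where
  "periodic n Q \<longleftrightarrow> (\<forall>x. x + n \<in> Q \<longleftrightarrow> x \<in> Q)"

definition count_mod :: "int \<Rightarrow> int set \<Rightarrow> nat" where
  "count_mod n Q = card (Q \<inter> {0..<n})"

text \<open>This is f of the overview, counted at the points \<open>x\<close> before the
  shift.\<close>

definition defect :: "int \<Rightarrow> int set \<Rightarrow> int \<Rightarrow> nat" where
  "defect n Q t = count_mod n {x \<in> Q. x + t \<notin> Q}"

lemma periodic_mult:
  assumes "periodic n Q" shows "x + k * n \<in> Q \<longleftrightarrow> x \<in> Q"
proof (induction k rule: int_induct[where k = 0])
  case base then show ?case by simp
next
  case (step1 i)
  have "x + i * n + n \<in> Q \<longleftrightarrow> x + i * n \<in> Q" using assms unfolding periodic_def by blast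
  with step1 show ?case by (simp add: algebra_simps)
next
  case (step2 i)
  have "x + (i - 1) * n + n \<in> Q \<longleftrightarrow> x + (i - 1) * n \<in> Q" using assms unfolding periodic_def by blast
  with step2 show ?case by (simp add: algebra_simps)
qed

lemma periodic_dvd:
  assumes "periodic n Q" "n dvd x - y" shows "x \<in> Q \<longleftrightarrow> y \<in> Q"
proof -
  obtain k where "x - y = n * k" using assms(2) by blast
  then have "x = y + k * n" by (simp add: algebra_simps)
  then show ?thesis using periodic_mult[OF assms(1), of y k] by simp
qed

lemma periodic_mod: "periodic n Q \<Longrightarrow> x mod n \<in> Q \<longleftrightarrow> x \<in> Q"
  using periodic_mult[of n Q "x mod n" "x div n"] by simp

lemma finite_Int_atLeastLessThan [simp]: "finite (Q \<inter> {a..<b::int})" "finite ({a..<b} \<inter> Q)"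
  by auto

lemma card_periodic_window:
  assumes "periodic n Q" "n > 0"
  shows "card (Q \<inter> {u..<u + n}) = count_mod n Q"
proof -
  have "bij_betw (\<lambda>x. x mod n) (Q \<inter> {u..<u + n}) (Q \<inter> {0..<n})"
  proof (rule bij_betwI[where g = "\<lambda>x. u + (x - u) mod n"])
    show "(\<lambda>x. x mod n) \<in> Q \<inter> {u..<u + n} \<rightarrow> Q \<inter> {0..<n}"
      using assms by (auto simp: periodic_mod)
    have "u + (x - u) mod n \<in> Q \<longleftrightarrow> x \<in> Q" for x
    proof (rule periodic_dvd[OF assms(1)])
      have "n dvd (x - u) - (x - u) mod n" by (rule dvd_minus_mod)
      then have "n dvd - ((x - u) - (x - u) mod n)" by (simp only: dvd_minus_iff)
      then show "n dvd u + (x - u) mod n - x" by (simp add: algebra_simps)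
    qed
    then show "(\<lambda>x. u + (x - u) mod n) \<in> Q \<inter> {0..<n} \<rightarrow> Q \<inter> {u..<u + n}"
      using assms by auto
  next
    fix x assume x: "x \<in> Q \<inter> {u..<u + n}"
    have "(x mod n - u) mod n = (x - u) mod n" by (simp add: mod_diff_left_eq)
    also have "\<dots> = x - u" using x by (intro mod_pos_pos_trivial) auto
    finally show "u + (x mod n - u) mod n = x" by simp
  next
    fix x assume x: "x \<in> Q \<inter> {0..<n}"
    have "(u + (x - u) mod n) mod n = (u + (x - u)) mod n" by (simp add: mod_add_right_eq)
    also have "\<dots> = x" using x by simp
    finally show "(u + (x - u) mod n) mod n = x" .
  qed
  then show ?thesis unfolding count_mod_def by (rule bij_betw_same_card)
qed

lemma card_periodic_windows:
  assumes "periodic n Q" "n > 0"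
  shows "card (Q \<inter> {u..<u + int k * n}) = k * count_mod n Q"
proof (induction k)
  case 0 then show ?case by simp
next
  case (Suc k)
  have "0 \<le> int k * n" using assms(2) by simp
  then have "{u..<u + int (Suc k) * n} = {u..<u + int k * n} \<union> {u + int k * n..<(u + int k * n) + n}"
    using assms(2) by (simp add: ivl_disj_un distrib_right add.assoc add.commute[of n])
  then have "card (Q \<inter> {u..<u + int (Suc k) * n}) =
      card (Q \<inter> {u..<u + int k * n} \<union> Q \<inter> {u + int k * n..<(u + int k * n) + n})"
    by (simp add: Int_Un_distrib)
  also have "\<dots> = card (Q \<inter> {u..<u + int k * n}) + card (Q \<inter> {u + int k * n..<(u + int k * n) + n})"
    by (rule card_Un_disjoint) auto
  finally show ?case using Suc.IH card_periodic_window[OF assms, of "u + int k * n"] by simp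
qed

lemma card_le_count:
  assumes "periodic n Q" "n > 0" "S \<subseteq> Q" "S \<subseteq> {u..<u + n}"
  shows "card S \<le> count_mod n Q"
proof -
  have "card S \<le> card (Q \<inter> {u..<u + n})" using assms by (intro card_mono) auto
  then show ?thesis using card_periodic_window[OF assms(1,2)] by simp
qed

lemma periodic_shift:
  assumes "periodic n Q" shows "periodic n {x. x + t \<in> Q}"
proof -
  have "x + n + t \<in> Q \<longleftrightarrow> x + t \<in> Q" for x
    using periodic_dvd[OF assms, of "x + n + t" "x + t"] by simp
  then show ?thesis unfolding periodic_def by simp
qed

lemma periodic_scale:
  assumes "periodic n Q" shows "periodic n {x. e * x \<in> Q}"
proof -
  have "e * (x + n) \<in> Q \<longleftrightarrow> e * x \<in> Q" for x
    using periodic_mult[OF assms, of "e * x" e] by (simp add: distrib_left)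
  then show ?thesis unfolding periodic_def by simp
qed

lemma periodic_Compl: "periodic n Q \<Longrightarrow> periodic n (- Q)"
  unfolding periodic_def by simp

lemma periodic_uminus: "periodic n Q \<Longrightarrow> periodic n {x. - x \<in> Q}"
  using periodic_scale[of n Q "-1"] by simp

lemma periodic_Un: "periodic n Q \<Longrightarrow> periodic n R \<Longrightarrow> periodic n (Q \<union> R)"
  unfolding periodic_def by simp

lemma periodic_residues: "periodic n {x. x mod n \<in> A}"
  unfolding periodic_def by simp

lemma count_mono: "Q \<subseteq> R \<Longrightarrow> count_mod n Q \<le> count_mod n R"
  unfolding count_mod_def by (intro card_mono) auto

lemma count_Un_Int: "count_mod n (Q \<union> R) + count_mod n (Q \<inter> R) = count_mod n Q + count_mod n R"
proof -
  have "Q \<inter> {0..<n} \<inter> (R \<inter> {0..<n}) = Q \<inter> R \<inter> {0..<n}" by auto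
  then show ?thesis
    unfolding count_mod_def using card_Un_Int[of "Q \<inter> {0..<n}" "R \<inter> {0..<n}"]
    by (simp add: Int_Un_distrib2)
qed

lemma count_Compl: "n > 0 \<Longrightarrow> int (count_mod n (- Q)) = n - int (count_mod n Q)"
proof -
  assume "n > 0"
  have "card (- Q \<inter> {0..<n}) + card (Q \<inter> {0..<n}) = card ((- Q \<inter> {0..<n}) \<union> (Q \<inter> {0..<n}))"
    by (rule card_Un_disjoint[symmetric]) auto
  also have "(- Q \<inter> {0..<n}) \<union> (Q \<inter> {0..<n}) = {0..<n}" by auto
  finally show ?thesis using \<open>n > 0\<close> unfolding count_mod_def by simp
qed

lemma count_shift:
  assumes "periodic n Q" "n > 0" shows "count_mod n {x. x + t \<in> Q} = count_mod n Q"
proof -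
  have "card ({x. x + t \<in> Q} \<inter> {0..<n}) = card (Q \<inter> {t..<t + n})"
    by (rule bij_betw_same_card[where f = "\<lambda>x. x + t"], rule bij_betwI[where g = "\<lambda>x. x - t"]) auto
  then show ?thesis using card_periodic_window[OF assms, of t] unfolding count_mod_def by simp
qed

lemma count_pos:
  assumes "periodic n Q" "n > 0" "x \<in> Q" shows "count_mod n Q > 0"
proof -
  have "x mod n \<in> Q \<inter> {0..<n}" using assms by (simp add: periodic_mod)
  then show ?thesis unfolding count_mod_def by (metis card_gt_0_iff empty_iff finite_Int_atLeastLessThan(1))
qed

lemma periodic_eq_if_residues:
  assumes "periodic n Q" "periodic n R" "\<And>x. x \<in> {0..<n} \<Longrightarrow> x \<in> Q \<longleftrightarrow> x \<in> R" "n > 0"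
  shows "Q = R"
proof (rule Set.set_eqI)
  fix x
  have "x mod n \<in> {0..<n}" using assms(4) by simp
  then show "x \<in> Q \<longleftrightarrow> x \<in> R"
    using assms(3) periodic_mod[OF assms(1), of x] periodic_mod[OF assms(2), of x] by blast
qed

lemma periodic_eqI_count:
  assumes "periodic n Q" "periodic n R" "n > 0" "Q \<subseteq> R" "count_mod n R \<le> count_mod n Q"
  shows "Q = R"
proof (rule periodic_eq_if_residues[OF assms(1,2) _ assms(3)])
  have "Q \<inter> {0..<n} = R \<inter> {0..<n}"
    using assms(4,5) unfolding count_mod_def by (intro card_seteq) auto
  then show "x \<in> Q \<longleftrightarrow> x \<in> R" if "x \<in> {0..<n}" for x using that by blast
qed

text \<open>A dilation by a unit permutes the residues. Such dilations turn a progression of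
  difference \<open>e\<close> into an interval.\<close>

lemma count_scale:
  assumes "periodic p Q" "prime p" "\<not> p dvd e"
  shows "count_mod p {x. e * x \<in> Q} = count_mod p Q"
proof -
  have p: "p > 0" using assms(2) prime_gt_0_int by blast
  have "coprime e p" using assms(2,3) by (metis coprime_commute prime_imp_coprime)
  then obtain e' where e': "[e * e' = 1] (mod p)" using cong_solve_coprime_int by blast
  have 1: "p dvd e * e' - 1" using e' by (simp add: cong_iff_dvd_diff)
  have inv: "e * (e' * x) mod p = x mod p" for x
  proof -
    have "p dvd (e * e' - 1) * x" using 1 by simp
    then show ?thesis by (simp add: mod_eq_dvd_iff algebra_simps)
  qed
  have "bij_betw (\<lambda>x. e * x mod p) ({x. e * x \<in> Q} \<inter> {0..<p}) (Q \<inter> {0..<p})"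
  proof (rule bij_betwI[where g = "\<lambda>x. e' * x mod p"])
    show "(\<lambda>x. e * x mod p) \<in> {x. e * x \<in> Q} \<inter> {0..<p} \<rightarrow> Q \<inter> {0..<p}"
      using p by (auto simp: periodic_mod[OF assms(1)])
    show "(\<lambda>x. e' * x mod p) \<in> Q \<inter> {0..<p} \<rightarrow> {x. e * x \<in> Q} \<inter> {0..<p}"
    proof
      fix x assume x: "x \<in> Q \<inter> {0..<p}"
      have "e * (e' * x mod p) mod p = x mod p" by (metis inv mod_mult_right_eq)
      then have "e * (e' * x mod p) \<in> Q" using x periodic_mod[OF assms(1)] by (metis IntE)
      then show "e' * x mod p \<in> {x. e * x \<in> Q} \<inter> {0..<p}" using p by simp
    qed
  next
    fix x assume x: "x \<in> {x. e * x \<in> Q} \<inter> {0..<p}"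
    have "e' * (e * x mod p) mod p = e * (e' * x) mod p" by (simp add: mod_mult_right_eq algebra_simps)
    then show "e' * (e * x mod p) mod p = x" using x inv by simp
  next
    fix x assume x: "x \<in> Q \<inter> {0..<p}"
    have "e * (e' * x mod p) mod p = e * (e' * x) mod p" by (simp add: mod_mult_right_eq)
    then show "e * (e' * x mod p) mod p = x" using x inv by simp
  qed
  then show ?thesis unfolding count_mod_def by (rule bij_betw_same_card)
qed

section \<open>The defect: symmetry, subadditivity, dilation\<close>

lemma periodic_defect_set:
  assumes "periodic n Q" shows "periodic n {x \<in> Q. x + t \<notin> Q}"
  using assms periodic_shift[OF assms, of t] unfolding periodic_def by simp

lemma defect_0 [simp]: "defect n Q 0 = 0"
  unfolding defect_def count_mod_def by simp

lemma defect_eq: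
  assumes "periodic n Q" "n > 0"
  shows "count_mod n {x \<in> Q. x + t \<in> Q} + defect n Q t = count_mod n Q"
proof -
  have "count_mod n ({x \<in> Q. x + t \<in> Q} \<union> {x \<in> Q. x + t \<notin> Q})
      + count_mod n ({x \<in> Q. x + t \<in> Q} \<inter> {x \<in> Q. x + t \<notin> Q}) = count_mod n {x \<in> Q. x + t \<in> Q} + defect n Q t"
    unfolding defect_def by (rule count_Un_Int)
  moreover have "{x \<in> Q. x + t \<in> Q} \<union> {x \<in> Q. x + t \<notin> Q} = Q"
    "{x \<in> Q. x + t \<in> Q} \<inter> {x \<in> Q. x + t \<notin> Q} = {}" by auto
  ultimately show ?thesis by (simp add: count_mod_def)
qed

text \<open>A shift by \<open>- t\<close> carries the pairs \<open>x\<close>, \<open>x + t\<close>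
  inside \<open>Q\<close> to the pairs \<open>x - t\<close>, \<open>x\<close>, so the part common to
  \<open>Q\<close> and its translate has the same size for both signs.\<close>

lemma defect_minus:
  assumes "periodic n Q" "n > 0"
  shows "defect n Q (- t) = defect n Q t"
proof -
  have per: "periodic n {x \<in> Q. x + t \<in> Q}"
    using assms(1) periodic_shift[OF assms(1), of t] unfolding periodic_def by simp
  have "{x. x + - t \<in> {x \<in> Q. x + t \<in> Q}} = {x \<in> Q. x + - t \<in> Q}" by auto
  then have "count_mod n {x \<in> Q. x + - t \<in> Q} = count_mod n {x \<in> Q. x + t \<in> Q}"
    using count_shift[OF per assms(2), of "- t"] by simp
  then show ?thesis using defect_eq[OF assms, of t] defect_eq[OF assms, of "- t"] by simp
qed

lemma defect_Compl:
  assumes "periodic n Q" "n > 0"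
  shows "defect n (- Q) t = defect n Q t"
proof -
  have "{x. x + - t \<in> {x \<in> - Q. x + t \<notin> - Q}} = {x \<in> Q. x + - t \<notin> Q}" by auto
  then have "defect n Q (- t) = defect n (- Q) t"
    using count_shift[OF periodic_defect_set[OF periodic_Compl[OF assms(1)]] assms(2), of "- t" t]
    unfolding defect_def by simp
  then show ?thesis using defect_minus[OF assms] by simp
qed

text \<open>A point \<open>x\<close> of \<open>Q\<close> with \<open>x + s + t\<close> outside
  leaves \<open>Q\<close> on the way to \<open>x + s\<close> or on the way from there to
  \<open>x + s + t\<close>.\<close>

lemma defect_add:
  assumes "periodic n Q" "n > 0"
  shows "defect n Q (s + t) \<le> defect n Q s + defect n Q t"
proof -
  let ?T = "{x. x + s \<in> {x \<in> Q. x + t \<notin> Q}}"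
  have "defect n Q (s + t) \<le> count_mod n ({x \<in> Q. x + s \<notin> Q} \<union> ?T)"
    unfolding defect_def by (rule count_mono) (auto simp: algebra_simps)
  also have "\<dots> \<le> count_mod n {x \<in> Q. x + s \<notin> Q} + count_mod n ?T"
    using count_Un_Int[of n "{x \<in> Q. x + s \<notin> Q}" ?T] by simp
  also have "\<dots> = defect n Q s + defect n Q t"
    using count_shift[OF periodic_defect_set[OF assms(1), of t] assms(2), of s] unfolding defect_def by simp
  finally show ?thesis .
qed

lemma defect_mult:
  assumes "periodic n Q" "n > 0"
  shows "defect n Q (int k * t) \<le> k * defect n Q t"
proof (induction k)
  case 0 then show ?case by simp
next
  case (Suc k)
  have "defect n Q (t + int k * t) \<le> defect n Q t + defect n Q (int k * t)"
    by (rule defect_add[OF assms])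
  with Suc show ?case by (simp add: algebra_simps)
qed

lemma defect_mult_abs:
  assumes "periodic n Q" "n > 0"
  shows "defect n Q (k * t) \<le> nat \<bar>k\<bar> * defect n Q t"
proof (cases "k \<ge> 0")
  case True then show ?thesis using defect_mult[OF assms, of "nat k" t] by simp
next
  case False
  then have "defect n Q (int (nat (- k)) * t) \<le> nat (- k) * defect n Q t" by (intro defect_mult[OF assms])
  then show ?thesis using False defect_minus[OF assms, of "k * t"] by simp
qed

lemma defect_scale:
  assumes "periodic p Q" "prime p" "\<not> p dvd e"
  shows "defect p {x. e * x \<in> Q} t = defect p Q (e * t)"
proof -
  have "{x \<in> {x. e * x \<in> Q}. x + t \<notin> {x. e * x \<in> Q}} = {x. e * x \<in> {x \<in> Q. x + e * t \<notin> Q}}"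
    by (auto simp: algebra_simps)
  then show ?thesis using count_scale[OF periodic_defect_set[OF assms(1), of "e * t"] assms(2,3)]
    unfolding defect_def by simp
qed

lemma periodic_defect_le:
  assumes "periodic n Q" shows "periodic n {t. defect n Q t \<le> k}"
proof -
  have "defect n Q (t + n) = defect n Q t" for t
  proof -
    have "x + (t + n) \<in> Q \<longleftrightarrow> x + t \<in> Q" for x
      using assms unfolding periodic_def by (metis add.assoc)
    then show ?thesis unfolding defect_def by simp
  qed
  then show ?thesis unfolding periodic_def by simp
qed

lemma defect_dvd:
  assumes "periodic n Q" "n dvd s - t" shows "defect n Q s = defect n Q t"
proof (rule antisym)
  show "defect n Q s \<le> defect n Q t"
    using periodic_dvd[OF periodic_defect_le[OF assms(1), of "defect n Q t"] assms(2)] by simp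
  show "defect n Q t \<le> defect n Q s"
    using periodic_dvd[OF periodic_defect_le[OF assms(1), of "defect n Q s"] assms(2)] by simp
qed

section \<open>Cauchy-Davenport and the level sets of the defect\<close>

text \<open>Dyson's e-transform moves points of \<open>T\<close> into \<open>S\<close> and keeps the
  total count. \<open>U\<close> is any set that contains all sums, so it stays fixed in the
  induction on the size of \<open>T\<close>.\<close>

lemma cauchy_davenport:
  assumes "prime p" "periodic p S" "periodic p T" "periodic p U" "S \<noteq> {}" "T \<noteq> {}"
    "\<And>s t. s \<in> S \<Longrightarrow> t \<in> T \<Longrightarrow> s + t \<in> U"
  shows "min p (int (count_mod p S) + int (count_mod p T) - 1) \<le> int (count_mod p U)"
  using assms(2,3,5-)
proof (induction "count_mod p T" arbitrary: S T rule: less_induct)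
  case less
  have p: "p > 0" using assms(1) prime_gt_0_int by blast
  note S = less.prems(1) and T = less.prems(2) and ST = less.prems(5)
  obtain t\<^sub>0 where t0: "t\<^sub>0 \<in> T" using less.prems(4) by blast
  obtain s\<^sub>0 where s0: "s\<^sub>0 \<in> S" using less.prems(3) by blast
  have sub: "{x. x + (- t\<^sub>0) \<in> S} \<subseteq> U"
  proof
    fix x assume "x \<in> {x. x + (- t\<^sub>0) \<in> S}"
    then have "(x + - t\<^sub>0) + t\<^sub>0 \<in> U" using ST t0 by blast
    then show "x \<in> U" by simp
  qed
  have SU: "count_mod p S \<le> count_mod p U"
    using count_mono[OF sub, of p] count_shift[OF S p, of "- t\<^sub>0"] by simp
  show ?case
  proof (cases "\<exists>t\<in>T. \<exists>t'\<in>T. \<not> p dvd t' - t")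
    case False
    have "count_mod p T \<le> 1"
      unfolding count_mod_def One_nat_def
    proof (subst card_le_Suc0_iff_eq, simp, intro ballI)
      fix x y assume xy: "x \<in> T \<inter> {0..<p}" "y \<in> T \<inter> {0..<p}"
      then have "p dvd x - y" using False by blast
      then have "x mod p = y mod p" by (simp add: mod_eq_dvd_iff)
      then show "x = y" using xy by simp
    qed
    then show ?thesis using SU by linarith
  next
    case True
    then obtain t t' where tt': "t \<in> T" "t' \<in> T" "\<not> p dvd t' - t" by blast
    show ?thesis
    proof (cases "\<forall>s\<in>S. s + (t' - t) \<in> S")
      \<comment> \<open>\<open>S\<close> is stable under a shift that is a unit modulo
        \<open>p\<close>, hence contains every residue.\<close>
      case True
      have *: "s\<^sub>0 + int k * (t' - t) \<in> S" for k
      proof (induction k)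
        case 0 then show ?case using s0 by simp
      next
        case (Suc k)
        have "s\<^sub>0 + int (Suc k) * (t' - t) = (s\<^sub>0 + int k * (t' - t)) + (t' - t)"
          by (simp add: algebra_simps)
        then show ?case using Suc True by metis
      qed
      have "coprime (t' - t) p" using tt'(3) assms(1) by (metis coprime_commute prime_imp_coprime)
      then obtain e where "[(t' - t) * e = 1] (mod p)" using cong_solve_coprime_int by blast
      then have e: "p dvd (t' - t) * e - 1" by (simp add: cong_iff_dvd_diff)
      have "x \<in> S" for x
      proof -
        let ?k = "e * (x - s\<^sub>0)"
        have "p dvd ?k mod p - ?k" by (metis dvd_diff_commute dvd_minus_mod)
        then have "p dvd (?k mod p - ?k) * (t' - t)" by simp
        moreover have "p dvd ((t' - t) * e - 1) * (x - s\<^sub>0)" using e by simp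
        ultimately have "p dvd (?k mod p - ?k) * (t' - t) + ((t' - t) * e - 1) * (x - s\<^sub>0)"
          by (rule dvd_add)
        then have "p dvd (s\<^sub>0 + (?k mod p) * (t' - t)) - x" by (simp add: algebra_simps)
        moreover have "s\<^sub>0 + (?k mod p) * (t' - t) \<in> S" using *[of "nat (?k mod p)"] p by simp
        ultimately show ?thesis using periodic_dvd[OF S] by blast
      qed
      then have "count_mod p S = card {0..<p}" unfolding count_mod_def by (metis UNIV_I UNIV_eq_I Int_UNIV_left)
      then show ?thesis using SU p by simp
    next
      case False
      then obtain s where s: "s \<in> S" "s + (t' - t) \<notin> S" by blast
      \<comment> \<open>With this shift \<open>t\<close> stays in \<open>T'\<close>, while
        \<open>t'\<close> drops out because \<open>t' + e = s + (t' - t)\<close> is outside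
        \<open>S\<close>; so \<open>T'\<close> is nonempty and strictly smaller than
        \<open>T\<close>.\<close>
      define e where "e = s - t"
      define S' where "S' = S \<union> {x. x + - e \<in> T}"
      define T' where "T' = {x \<in> T. x + e \<in> S}"
      have pT: "periodic p {x. x + - e \<in> T}" by (rule periodic_shift[OF T])
      have perS: "periodic p S'" unfolding S'_def by (rule periodic_Un[OF S pT])
      have perT: "periodic p T'" using T periodic_shift[OF S, of e] unfolding T'_def periodic_def by simp
      have "{x. x + - e \<in> T'} = S \<inter> {x. x + - e \<in> T}" unfolding T'_def by auto
      then have "count_mod p T' = count_mod p (S \<inter> {x. x + - e \<in> T})"
        using count_shift[OF perT p, of "- e"] by simp
      then have sum: "count_mod p S' + count_mod p T' = count_mod p S + count_mod p T"
        using count_Un_Int[of p S "{x. x + - e \<in> T}"] count_shift[OF T p, of "- e"] unfolding S'_def by simp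
      have "T' \<noteq> T" using tt'(2) s unfolding T'_def e_def by (auto simp: algebra_simps)
      moreover have "T' \<subseteq> T" unfolding T'_def by blast
      ultimately have less': "count_mod p T' < count_mod p T"
        using periodic_eqI_count[OF perT T p] by (meson not_le)
      have "t \<in> T'" using tt' s unfolding T'_def e_def by simp
      moreover have "s' + t'' \<in> U" if "s' \<in> S'" "t'' \<in> T'" for s' t''
      proof (cases "s' \<in> S")
        case True then show ?thesis using that ST unfolding T'_def by blast
      next
        case False
        then have "s' + - e \<in> T" "t'' + e \<in> S" using that unfolding S'_def T'_def by auto
        then have "(t'' + e) + (s' + - e) \<in> U" using ST by blast
        then show ?thesis by (simp add: algebra_simps)
      qed
      moreover have "S' \<noteq> {}" using s unfolding S'_def by blast
      ultimately have "min p (int (count_mod p S') + int (count_mod p T') - 1) \<le> int (count_mod p U)"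
        using less.hyps[OF less' perS perT] by blast
      then show ?thesis using sum by linarith
    qed
  qed
qed

text \<open>By subadditivity the level set at \<open>k * \<rho>\<close> contains the
  \<open>k\<close>-fold sumset of the level set at \<open>\<rho>\<close>.\<close>

lemma count_defect_le_mult:
  assumes "prime p" "periodic p Q"
  shows "min p (int k * (int (count_mod p {t. defect p Q t \<le> \<rho>}) - 1) + 1) \<le> int (count_mod p {t. defect p Q t \<le> k * \<rho>})"
proof (induction k)
  have p: "p > 0" using assms(1) prime_gt_0_int by blast
  case 0
  have "count_mod p {t. defect p Q t \<le> 0} > 0"
    by (rule count_pos[OF periodic_defect_le[OF assms(2)] p, of 0]) simp
  then show ?case by simp
next
  have p: "p > 0" using assms(1) prime_gt_0_int by blast
  case (Suc k)
  have "count_mod p {t. defect p Q t \<le> \<rho>} > 0"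
    by (rule count_pos[OF periodic_defect_le[OF assms(2)] p, of 0]) simp
  moreover have "min p (int (count_mod p {t. defect p Q t \<le> k * \<rho>}) + int (count_mod p {t. defect p Q t \<le> \<rho>}) - 1)
     \<le> int (count_mod p {t. defect p Q t \<le> Suc k * \<rho>})"
  proof (rule cauchy_davenport[OF assms(1)])
    fix s t assume "s \<in> {t. defect p Q t \<le> k * \<rho>}" "t \<in> {t. defect p Q t \<le> \<rho>}"
    then show "s + t \<in> {t. defect p Q t \<le> Suc k * \<rho>}"
      using defect_add[OF assms(2) p, of s t] by simp
  next
    have "0 \<in> {t. defect p Q t \<le> k * \<rho>}" "0 \<in> {t. defect p Q t \<le> \<rho>}" by auto
    then show "{t. defect p Q t \<le> k * \<rho>} \<noteq> {}" "{t. defect p Q t \<le> \<rho>} \<noteq> {}" by blast+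
  qed (rule periodic_defect_le[OF assms(2)])+
  ultimately show ?case using Suc by (simp add: algebra_simps) 
qed

text \<open>A right-endpoint Riemann sum of a decreasing function stays below the area of the
  triangle with legs \<open>a\<close> and \<open>a / c\<close>.\<close>

lemma sum_truncated_linear_le:
  fixes a c :: real
  assumes "a \<ge> 0" "c > 0"
  shows "(\<Sum>i<n. max 0 (a - c * real (Suc i))) \<le> a\<^sup>2 / (2 * c)"
  using assms(1)
proof (induction n arbitrary: a)
  case 0 then show ?case using assms(2) by simp
next
  case (Suc n)
  show ?case
  proof (cases "a \<ge> c")
    case True
    have "(\<Sum>i<Suc n. max 0 (a - c * real (Suc i)))
        = max 0 (a - c) + (\<Sum>i<n. max 0 ((a - c) - c * real (Suc i)))"
      by (subst sum.lessThan_Suc_shift) (simp add: algebra_simps)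
    also have "\<dots> \<le> (a - c) + (a - c)\<^sup>2 / (2 * c)" using Suc.IH[of "a - c"] True by simp
    also have "\<dots> = (a\<^sup>2 - c\<^sup>2) / (2 * c)" using assms(2) by (simp add: field_simps power2_eq_square)
    also have "\<dots> \<le> a\<^sup>2 / (2 * c)" using assms(2) by (simp add: divide_right_mono)
    finally show ?thesis .
  next
    case False
    have "max 0 (a - c * real (Suc i)) = 0" for i
    proof -
      have "c * 1 \<le> c * real (Suc i)" using assms(2) by (intro mult_left_mono) auto
      then show ?thesis using False by simp
    qed
    then show ?thesis using assms(2) by simp
  qed
qed

lemma sum_count_eq:
  assumes "\<And>i. periodic n (R i)" "n > 0" "finite I"
  shows "(\<Sum>i\<in>I. count_mod n (R i)) = (\<Sum>x\<in>{0..<n}. card {i\<in>I. x \<in> R i})"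
proof -
  have "(\<Sum>i\<in>I. count_mod n (R i)) = (\<Sum>i\<in>I. \<Sum>x\<in>{0..<n}. if x \<in> R i then 1 else 0)"
    unfolding count_mod_def by (intro sum.cong) (auto simp: sum.If_cases Int_commute)
  also have "\<dots> = (\<Sum>x\<in>{0..<n}. \<Sum>i\<in>I. if x \<in> R i then 1 else 0)" by (rule sum.swap)
  also have "\<dots> = (\<Sum>x\<in>{0..<n}. card {i\<in>I. x \<in> R i})"
    using assms(3) by (intro sum.cong) (auto simp: sum.If_cases Int_def)
  finally show ?thesis .
qed

lemma sum_common:
  assumes "periodic n Q" "n > 0"
  shows "(\<Sum>t\<in>{0..<n}. count_mod n {x \<in> Q. x + t \<in> Q}) = (count_mod n Q)\<^sup>2"
proof -
  have "periodic n {x \<in> Q. x + t \<in> Q}" for t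
    using assms(1) periodic_shift[OF assms(1), of t] unfolding periodic_def by simp
  then have "(\<Sum>t\<in>{0..<n}. count_mod n {x \<in> Q. x + t \<in> Q})
      = (\<Sum>x\<in>{0..<n}. card {t \<in> {0..<n}. x \<in> {x \<in> Q. x + t \<in> Q}})"
    by (intro sum_count_eq assms) auto
  also have "\<dots> = (\<Sum>x\<in>{0..<n}. if x \<in> Q then count_mod n Q else 0)"
  proof (rule sum.cong[OF refl])
    fix x
    have "{t \<in> {0..<n}. x + t \<in> Q} = {t. t + x \<in> Q} \<inter> {0..<n}" by (auto simp: add.commute)
    then have "card {t \<in> {0..<n}. x + t \<in> Q} = count_mod n Q"
      using count_shift[OF assms, of x] unfolding count_mod_def by simp
    then show "card {t \<in> {0..<n}. x \<in> {x \<in> Q. x + t \<in> Q}} = (if x \<in> Q then count_mod n Q else 0)" by simp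
  qed
  also have "\<dots> = (count_mod n Q)\<^sup>2"
    by (simp add: sum.If_cases power2_eq_square) (simp add: count_mod_def Int_commute)
  finally show ?thesis .
qed

text \<open>Layer-cake count: a shift \<open>t\<close> lies in the level sets from its defect up to
  the size of \<open>Q\<close>, and the number of these is the size of the part common to
  \<open>Q\<close> and its translate.\<close>

lemma sum_count_defect_le:
  assumes "periodic n Q" "n > 0"
  shows "(\<Sum>\<sigma><count_mod n Q. count_mod n {t. defect n Q t \<le> \<sigma>}) = (count_mod n Q)\<^sup>2"
proof -
  have "(\<Sum>\<sigma><count_mod n Q. count_mod n {t. defect n Q t \<le> \<sigma>})
      = (\<Sum>t\<in>{0..<n}. card {\<sigma> \<in> {..<count_mod n Q}. t \<in> {t. defect n Q t \<le> \<sigma>}})"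
    by (intro sum_count_eq periodic_defect_le assms) auto
  also have "\<dots> = (\<Sum>t\<in>{0..<n}. count_mod n {x \<in> Q. x + t \<in> Q})"
  proof (rule sum.cong[OF refl])
    fix t
    have "{\<sigma> \<in> {..<count_mod n Q}. t \<in> {t. defect n Q t \<le> \<sigma>}} = {defect n Q t..<count_mod n Q}" by auto
    then show "card {\<sigma> \<in> {..<count_mod n Q}. t \<in> {t. defect n Q t \<le> \<sigma>}} = count_mod n {x \<in> Q. x + t \<in> Q}"
      using defect_eq[OF assms, of t] by simp
  qed
  finally show ?thesis using sum_common[OF assms] by simp
qed

text \<open>If more than \<open>5\<rho>/2\<close> shifts had defect at most \<open>\<rho>\<close>, Cauchy--Davenport would give linear growth of the
  level sets with slope above \<open>5/2\<close>, up to \<open>p \<ge> 2N\<close>; this contradicts that they sum to \<open>N\<^sup>2\<close>.\<close>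
lemma count_defect_le_half:
  assumes "prime p" "periodic p Q" "2 * int (count_mod p Q) \<le> p" "40 * \<rho> \<le> count_mod p Q" "\<rho> \<ge> 1"
  shows "2 * count_mod p {t. defect p Q t \<le> \<rho>} \<le> 5 * \<rho> + 2"
proof (rule ccontr)
  assume neg: "\<not> ?thesis"
  define L where "L \<sigma> = count_mod p {t. defect p Q t \<le> \<sigma>}" for \<sigma>
  define N where "N = count_mod p Q"
  have p: "p > 0" using assms(1) prime_gt_0_int by blast
  have big: "2 * (int (L \<rho>) - 1) > 5 * int \<rho>" 
  proof -
    have "int (5 * \<rho> + 2) < int (2 * L \<rho>)" using neg unfolding L_def of_nat_less_iff by simp
    then show ?thesis by simp
  qed
  \<comment> \<open>Rounding \<open>\<sigma>\<close> down to a multiple of \<open>\<rho>\<close>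
    costs at most one \<open>\<rho>\<close>, hence the extra term
    \<open>5/2 * real \<rho>\<close>.\<close>
  have bound: "2 * real N - real (L \<sigma>) \<le> max 0 ((2 * real N + 5/2 * real \<rho>) - 5/2 * real (Suc \<sigma>))" for \<sigma>
  proof -
    define j where "j = \<sigma> div \<rho>"
    have j: "j * \<rho> \<le> \<sigma>" "Suc \<sigma> \<le> j * \<rho> + \<rho>"
      using assms(5) dividend_less_div_times[of \<rho> \<sigma>] unfolding j_def by auto
    have "min p (int j * (int (L \<rho>) - 1) + 1) \<le> int (L (j * \<rho>))"
      unfolding L_def by (rule count_defect_le_mult[OF assms(1,2)])
    also have "int (L (j * \<rho>)) \<le> int (L \<sigma>)" 
      unfolding L_def of_nat_le_iff using j(1) by (intro count_mono) auto
    finally have m: "min p (int j * (int (L \<rho>) - 1) + 1) \<le> int (L \<sigma>)" .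
    show ?thesis
    proof (cases "p \<le> int (L \<sigma>)")
      case True
      then have "2 * real N \<le> real (L \<sigma>)" using assms(3) unfolding N_def by linarith
      then show ?thesis by simp
    next
      case False
      have "int j * (5 * int \<rho>) \<le> int j * (2 * (int (L \<rho>) - 1))" using big by (intro mult_left_mono) auto
      then have "5 * (int j * int \<rho>) \<le> 2 * (int j * (int (L \<rho>) - 1))" by (simp add: algebra_simps)
      then have "5 * (int j * int \<rho>) \<le> 2 * int (L \<sigma>)" using m False by linarith
      moreover have "int (Suc \<sigma>) \<le> int j * int \<rho> + int \<rho>" using j(2) by (metis of_nat_add of_nat_le_iff of_nat_mult)
      ultimately have "5 * int (Suc \<sigma>) \<le> 2 * int (L \<sigma>) + 5 * int \<rho>"
        by (smt (verit) distrib_left mult_left_mono)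
      then have "5 * real (Suc \<sigma>) \<le> 2 * real (L \<sigma>) + 5 * real \<rho>" by linarith
      then show ?thesis by linarith
    qed
  qed
  have N: "real N \<ge> 40 * real \<rho>" "real \<rho> \<ge> 1" using assms(4,5) unfolding N_def by linarith+
  have "(\<Sum>\<sigma><N. 2 * real N - real (L \<sigma>)) \<le> (\<Sum>\<sigma><N. max 0 ((2 * real N + 5/2 * real \<rho>) - 5/2 * real (Suc \<sigma>)))"
    by (intro sum_mono bound)
  also have "\<dots> \<le> (2 * real N + 5/2 * real \<rho>)\<^sup>2 / (2 * (5/2))"
    by (rule sum_truncated_linear_le) auto
  \<comment> \<open>Without the rounding term the slope 5/2 would give 4/5 of the square of
    \<open>N\<close>; any slope above 2 gives less than the full square. The factor 40 makes the
    rounding term at most \<open>N / 16\<close>, which still leaves only 1089/1280.\<close>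
  also have "(2 * real N + 5/2 * real \<rho>)\<^sup>2 \<le> (2 * real N + real N / 16)\<^sup>2"
    using N by (intro power_mono) auto
  finally have "(\<Sum>\<sigma><N. 2 * real N - real (L \<sigma>)) \<le> (33/16 * real N)\<^sup>2 / 5" by (simp add: divide_right_mono)
  moreover have "real (\<Sum>\<sigma><N. L \<sigma>) = (real N)\<^sup>2"
    unfolding L_def N_def sum_count_defect_le[OF assms(2) p] by simp
  then have "(\<Sum>\<sigma><N. 2 * real N - real (L \<sigma>)) = (real N)\<^sup>2"
    by (simp add: sum_subtractf power2_eq_square)
  ultimately have "(real N)\<^sup>2 \<le> 1089/1280 * (real N)\<^sup>2" by (simp add: power2_eq_square)
  then show False using N by (simp add: power2_eq_square)
qed

text \<open>A set with more than half of the residues is replaced by its complement, which has the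
  same defects.\<close>

lemma count_defect_le:
  assumes "prime p" "periodic p Q" "40 * \<rho> \<le> count_mod p Q" "int (count_mod p Q) + 40 * int \<rho> \<le> p" "\<rho> \<ge> 1"
  shows "2 * count_mod p {t. defect p Q t \<le> \<rho>} \<le> 5 * \<rho> + 2"
proof (cases "2 * int (count_mod p Q) \<le> p")
  case True then show ?thesis using count_defect_le_half assms by blast
next
  case False
  have p: "p > 0" using assms(1) prime_gt_0_int by blast
  have "2 * count_mod p {t. defect p (- Q) t \<le> \<rho>} \<le> 5 * \<rho> + 2"
    using False assms count_Compl[OF p, of Q] by (intro count_defect_le_half periodic_Compl) auto
  then show ?thesis using defect_Compl[OF assms(2) p] by simp
qed

section \<open>Fourier analysis: a dilation that concentrates most of B\<close>

text \<open>Orthogonality of characters, as the real part of a geometric sum of \<open>n\<close>-th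
  roots of unity.\<close>

lemma sum_cos_multiples:
  fixes n :: nat and k :: int
  assumes "n > 0"
  shows "(\<Sum>i<n. cos (2 * pi * real i * of_int k / real n)) = (if int n dvd k then real n else 0)"
proof (cases "int n dvd k")
  case True
  then obtain m where m: "k = int n * m" by blast
  have "cos (2 * pi * real i * of_int k / real n) = 1" for i
  proof -
    have "2 * pi * real i * of_int k / real n = of_int (int i * m) * 2 * pi"
      using assms by (simp add: m)
    then show ?thesis using cos_one_2pi_int by metis
  qed
  then show ?thesis using True by simp
next
  case False
  define z where "z = cis (2 * pi * of_int k / real n)"
  have "z \<noteq> 1"
  proof
    assume "z = 1"
    then have "cos (2 * pi * of_int k / real n) = 1" unfolding z_def by (metis Re_complex_of_real cis.sel(1) of_real_1)
    then obtain m :: int where "2 * pi * of_int k / real n = of_int m * 2 * pi" using cos_one_2pi_int by blast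
    then have "real_of_int k = of_int m * real n" using assms by (simp add: field_simps)
    then have "k = m * int n" by (metis of_int_eq_iff of_int_mult of_int_of_nat_eq)
    then show False using False by simp
  qed
  moreover have "z ^ n = 1"
  proof -
    have "z ^ n = cis (2 * pi * of_int k)" unfolding z_def using assms by (simp add: DeMoivre)
    also have "\<dots> = 1" by (simp add: cis_multiple_2pi)
    finally show ?thesis .
  qed
  ultimately have "(\<Sum>i<n. z ^ i) = 0" by (simp add: geometric_sum)
  then have "(\<Sum>i<n. Re (z ^ i)) = 0" by (metis Re_sum zero_complex.sel(1))
  then show ?thesis using False unfolding z_def by (simp add: DeMoivre mult.left_commute mult.assoc mult.commute)
qed

text \<open>The squared modulus of the Fourier transform of \<open>A\<close> at frequency
  \<open>i\<close>, kept as a sum of two real squares.\<close>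

definition fourier_weight :: "int set \<Rightarrow> nat \<Rightarrow> nat \<Rightarrow> real" where
  "fourier_weight A n i = (\<Sum>x\<in>A. cos (2 * pi * real i * of_int x / real n))\<^sup>2
     + (\<Sum>x\<in>A. sin (2 * pi * real i * of_int x / real n))\<^sup>2"

lemma fourier_weight_nonneg: "fourier_weight A n i \<ge> 0"
  unfolding fourier_weight_def by simp

lemma fourier_weight_eq:
  "fourier_weight A n i = (\<Sum>x\<in>A. \<Sum>y\<in>A. cos (2 * pi * real i * of_int (x - y) / real n))"
proof -
  have "cos (2 * pi * real i * of_int (x - y) / real n) =
     cos (2 * pi * real i * of_int x / real n) * cos (2 * pi * real i * of_int y / real n) +
     sin (2 * pi * real i * of_int x / real n) * sin (2 * pi * real i * of_int y / real n)" for x y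
    unfolding cos_diff[symmetric] by (simp add: right_diff_distrib diff_divide_distrib)
  then show ?thesis
    unfolding fourier_weight_def power2_eq_square sum_product by (simp add: sum.distrib)
qed

text \<open>Fourier inversion for the autocorrelation of \<open>Q\<close>: after the weight is
  expanded over pairs \<open>x\<close>, \<open>y\<close>, orthogonality keeps those with
  \<open>x - y\<close> equal to \<open>t\<close> or \<open>- t\<close> modulo
  \<open>n\<close>.\<close>

lemma sum_fourier_weight:
  assumes "periodic (int n) Q" "n > 0"
  shows "(\<Sum>i<n. fourier_weight (Q \<inter> {0..<int n}) n i * cos (2 * pi * real i * of_int t / real n))
     = real n * real (count_mod (int n) {x \<in> Q. x + t \<in> Q})"
proof -
  let ?A = "Q \<inter> {0..<int n}"
  let ?c = "\<lambda>i k. cos (2 * pi * real i * of_int k / real n)"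
  let ?d = "\<lambda>k. if int n dvd k then real n else 0"
  \<comment> \<open>The second cosine is written at \<open>y - x + t\<close> so that exchanging
    \<open>x\<close> and \<open>y\<close> turns it into the first.\<close>
  have prod: "?c i (x - y) * ?c i t = (?c i (x - y + t) + ?c i (y - x + t)) / 2" for i x y
  proof -
    have *: "?c i (u + v) = cos (2 * pi * real i * of_int u / real n + 2 * pi * real i * of_int v / real n)"
      for u v by (simp add: distrib_left add_divide_distrib)
    have "?c i (y - x) = ?c i (x - y)" "sin (2 * pi * real i * of_int (y - x) / real n)
        = - sin (2 * pi * real i * of_int (x - y) / real n)"
      by (metis (no_types) cos_minus sin_minus minus_diff_eq of_int_minus mult_minus_right minus_divide_left)+
    then show ?thesis unfolding * cos_add by simp
  qed
  have inner: "(\<Sum>x\<in>?A. \<Sum>y\<in>?A. ?d (x - y + t)) = real n * real (count_mod (int n) {x \<in> Q. x + t \<in> Q})"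
  proof -
    have "(\<Sum>y\<in>?A. ?d (x - y + t)) = (if x + t \<in> Q then real n else 0)" for x
    proof -
      let ?y = "(x + t) mod int n"
      have iff: "int n dvd x - y + t \<longleftrightarrow> y = ?y" if "y \<in> ?A" for y
      proof -
        have "int n dvd x - y + t \<longleftrightarrow> (x + t) mod int n = y mod int n"
          by (simp add: mod_eq_dvd_iff algebra_simps)
        then show ?thesis using that by auto
      qed
      have "(\<Sum>y\<in>?A. ?d (x - y + t)) = (\<Sum>y\<in>?A. if y = ?y then real n else 0)"
        using iff by (intro sum.cong) auto
      also have "\<dots> = (if ?y \<in> ?A then real n else 0)" by (simp add: sum.delta)
      also have "?y \<in> ?A \<longleftrightarrow> x + t \<in> Q" using assms periodic_mod[OF assms(1), of "x + t"] by auto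
      finally show ?thesis .
    qed
    then have "(\<Sum>x\<in>?A. \<Sum>y\<in>?A. ?d (x - y + t)) = (\<Sum>x\<in>?A. if x + t \<in> Q then real n else 0)" by simp
    also have "\<dots> = real n * real (card {x \<in> ?A. x + t \<in> Q})"
      by (simp add: sum.If_cases Int_def)
    also have "{x \<in> ?A. x + t \<in> Q} = {x \<in> Q. x + t \<in> Q} \<inter> {0..<int n}" by auto
    finally show ?thesis unfolding count_mod_def .
  qed
  have "(\<Sum>i<n. fourier_weight ?A n i * ?c i t)
      = (\<Sum>i<n. \<Sum>x\<in>?A. \<Sum>y\<in>?A. (?c i (x - y + t) + ?c i (y - x + t)) / 2)"
    unfolding fourier_weight_eq sum_distrib_right prod ..
  also have "\<dots> = (\<Sum>x\<in>?A. \<Sum>i<n. \<Sum>y\<in>?A. (?c i (x - y + t) + ?c i (y - x + t)) / 2)" by (rule sum.swap)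
  also have "\<dots> = (\<Sum>x\<in>?A. \<Sum>y\<in>?A. \<Sum>i<n. (?c i (x - y + t) + ?c i (y - x + t)) / 2)"
    by (intro sum.cong[OF refl] sum.swap)
  also have "\<dots> = (\<Sum>x\<in>?A. \<Sum>y\<in>?A. (?d (x - y + t) + ?d (y - x + t)) / 2)"
    unfolding sum_divide_distrib[symmetric] sum.distrib sum_cos_multiples[OF assms(2)] ..
  also have "\<dots> = ((\<Sum>x\<in>?A. \<Sum>y\<in>?A. ?d (x - y + t)) + (\<Sum>x\<in>?A. \<Sum>y\<in>?A. ?d (y - x + t))) / 2"
    unfolding sum_divide_distrib[symmetric] sum.distrib ..
  also have "(\<Sum>x\<in>?A. \<Sum>y\<in>?A. ?d (y - x + t)) = (\<Sum>y\<in>?A. \<Sum>x\<in>?A. ?d (y - x + t))" by (rule sum.swap)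
  finally show ?thesis unfolding inner by simp
qed

text \<open>Over the nonzero frequencies the weighted sum of \<open>1 - cos\<close> at
  \<open>t\<close> is exactly \<open>n\<close> times the defect of \<open>t\<close>, and the weights
  add up to \<open>a * (n - a)\<close> for \<open>a\<close> the size of \<open>Q\<close>. Averaging
  over all pairs in \<open>B\<close> and over the frequencies leaves one frequency and one base
  point \<open>b\<^sub>0\<close> with small deviation.\<close>

lemma exists_concentrating_frequency:
  assumes "periodic (int n) Q" "0 < count_mod (int n) Q" "count_mod (int n) Q < n"
    "finite B" "B \<noteq> {}" "\<And>b b'. b \<in> B \<Longrightarrow> b' \<in> B \<Longrightarrow> defect (int n) Q (b - b') \<le> r"
  shows "\<exists>i\<in>{1..<n}. \<exists>b\<^sub>0\<in>B. real (count_mod (int n) Q) * (real n - real (count_mod (int n) Q)) *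
      (\<Sum>b\<in>B. 1 - cos (2 * pi * real i * of_int (b - b\<^sub>0) / real n)) \<le> real n * real r * real (card B)"
proof (rule ccontr)
  assume neg: "\<not> ?thesis"
  define a where "a = real (count_mod (int n) Q)"
  define w where "w i = fourier_weight (Q \<inter> {0..<int n}) n i" for i
  define c where "c i k = cos (2 * pi * real i * of_int k / real n)" for i and k :: int
  have n: "n > 0" using assms(3) by simp
  have a: "a > 0" "a < real n" using assms(2,3) unfolding a_def by auto
  have w0: "w 0 = a\<^sup>2" unfolding w_def fourier_weight_def a_def count_mod_def by simp
  have split: "(\<Sum>i<n. h i) = h 0 + (\<Sum>i\<in>{1..<n}. h i)" for h :: "nat \<Rightarrow> real"
  proof -
    have "{..<n} = insert 0 {1..<n}" using n by auto
    then show ?thesis by simp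
  qed
  have tot: "(\<Sum>i\<in>{1..<n}. w i) = a * (real n - a)"
  proof -
    have "(\<Sum>i<n. w i) = real n * a"
      using sum_fourier_weight[OF assms(1) n, of 0] unfolding w_def a_def by simp
    then show ?thesis using split[of w] w0 by (simp add: algebra_simps power2_eq_square)
  qed
  have var: "(\<Sum>i\<in>{1..<n}. w i * (1 - c i t)) = real n * real (defect (int n) Q t)" for t
  proof -
    have "(\<Sum>i<n. w i * c i t) = real n * real (count_mod (int n) {x \<in> Q. x + t \<in> Q})"
      unfolding w_def c_def by (rule sum_fourier_weight[OF assms(1) n])
    also have "real (count_mod (int n) {x \<in> Q. x + t \<in> Q}) = a - real (defect (int n) Q t)"
      using defect_eq[OF assms(1), of t] n unfolding a_def by linarith
    finally have "(\<Sum>i\<in>{1..<n}. w i * c i t) = real n * (a - real (defect (int n) Q t)) - a\<^sup>2"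
      using split[of "\<lambda>i. w i * c i t"] w0 by (simp add: c_def)
    then show ?thesis using tot by (simp add: right_diff_distrib sum_subtractf algebra_simps power2_eq_square)
  qed
  have pos: "a * (real n - a) > 0" using a by simp
  \<comment> \<open>The weights are only nonnegative, so strictness of the summed inequality needs
    one positive weight.\<close>
  have i1: "\<exists>i\<in>{1..<n}. w i > 0"
  proof (rule ccontr)
    assume "\<not> ?thesis"
    then have "(\<Sum>i\<in>{1..<n}. w i) \<le> 0" by (intro sum_nonpos) (auto simp: not_less)
    then show False using tot pos by simp
  qed
  have cB: "card B > 0" using assms(4,5) by (simp add: card_gt_0_iff)
  have big: "real n * real r * (real (card B))\<^sup>2 < a * (real n - a) * (\<Sum>b'\<in>B. \<Sum>b\<in>B. 1 - c i (b - b'))"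
    if "i \<in> {1..<n}" for i
  proof -
    have "(\<Sum>b'\<in>B. real n * real r * real (card B)) < (\<Sum>b'\<in>B. a * (real n - a) * (\<Sum>b\<in>B. 1 - c i (b - b')))"
      using neg that assms(4,5) unfolding c_def a_def by (intro sum_strict_mono) (auto simp: not_le)
    then show ?thesis by (simp add: sum_distrib_left power2_eq_square algebra_simps)
  qed
  have "(\<Sum>i\<in>{1..<n}. w i * (real n * real r * (real (card B))\<^sup>2))
      < (\<Sum>i\<in>{1..<n}. w i * (a * (real n - a) * (\<Sum>b'\<in>B. \<Sum>b\<in>B. 1 - c i (b - b'))))"
  proof (rule sum_strict_mono_ex1)
    show "\<forall>i\<in>{1..<n}. w i * (real n * real r * (real (card B))\<^sup>2)
        \<le> w i * (a * (real n - a) * (\<Sum>b'\<in>B. \<Sum>b\<in>B. 1 - c i (b - b')))"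
      using big fourier_weight_nonneg unfolding w_def by (meson less_imp_le mult_left_mono)
    show "\<exists>i\<in>{1..<n}. w i * (real n * real r * (real (card B))\<^sup>2)
        < w i * (a * (real n - a) * (\<Sum>b'\<in>B. \<Sum>b\<in>B. 1 - c i (b - b')))"
      using i1 big by (meson mult_strict_left_mono)
  qed simp
  also have "\<dots> = a * (real n - a) * (\<Sum>i\<in>{1..<n}. \<Sum>b'\<in>B. \<Sum>b\<in>B. w i * (1 - c i (b - b')))"
    by (simp add: sum_distrib_left algebra_simps)
  also have "(\<Sum>i\<in>{1..<n}. \<Sum>b'\<in>B. \<Sum>b\<in>B. w i * (1 - c i (b - b')))
      = (\<Sum>b'\<in>B. \<Sum>i\<in>{1..<n}. \<Sum>b\<in>B. w i * (1 - c i (b - b')))" by (rule sum.swap)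
  also have "\<dots> = (\<Sum>b'\<in>B. \<Sum>b\<in>B. \<Sum>i\<in>{1..<n}. w i * (1 - c i (b - b')))"
    by (intro sum.cong[OF refl] sum.swap)
  also have "\<dots> = (\<Sum>b'\<in>B. \<Sum>b\<in>B. real n * real (defect (int n) Q (b - b')))" unfolding var ..
  also have "a * (real n - a) * \<dots> \<le> a * (real n - a) * (\<Sum>b'\<in>B. \<Sum>b\<in>B. real n * real r)"
    using pos assms(6) by (intro mult_left_mono sum_mono) auto
  also have "\<dots> = (\<Sum>i\<in>{1..<n}. w i * (real n * real r * (real (card B))\<^sup>2))"
    unfolding sum_distrib_right[symmetric] tot by (simp add: power2_eq_square)
  finally show False by simp
qed

text \<open>Markov's inequality: if \<open>\<xi> * (b - b\<^sub>0)\<close> is at least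
  \<open>n / 100\<close> away from all multiples of \<open>n\<close>, its angle is at least
  \<open>2 * pi / 100\<close>, and \<open>b\<close> adds at least \<open>\<delta>\<close> to the
  sum.\<close>

lemma concentration:
  fixes \<delta> :: real
  assumes "periodic (int n) Q" "0 < count_mod (int n) Q" "count_mod (int n) Q < n"
    "finite B" "B \<noteq> {}" "\<And>b b'. b \<in> B \<Longrightarrow> b' \<in> B \<Longrightarrow> defect (int n) Q (b - b') \<le> r"
    and \<delta>: "\<delta> = 1 - cos (pi / 50)"
  shows "\<exists>\<xi>. \<exists>b\<^sub>0\<in>B. 0 < \<xi> \<and> \<xi> < int n \<and>
    real (count_mod (int n) Q) * (real n - real (count_mod (int n) Q)) *
      (\<delta> * real (card {b \<in> B. \<not> (\<exists>k. 100 * \<bar>\<xi> * (b - b\<^sub>0) - k * int n\<bar> < int n)}))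
    \<le> real n * real r * real (card B)"
proof -
  have n: "n > 0" using assms(3) by simp
  obtain i b\<^sub>0 where i: "i \<in> {1..<n}" "b\<^sub>0 \<in> B"
    and le: "real (count_mod (int n) Q) * (real n - real (count_mod (int n) Q)) *
      (\<Sum>b\<in>B. 1 - cos (2 * pi * real i * of_int (b - b\<^sub>0) / real n)) \<le> real n * real r * real (card B)"
    using exists_concentrating_frequency[OF assms(1-6)] by blast
  let ?E = "{b \<in> B. \<not> (\<exists>k. 100 * \<bar>int i * (b - b\<^sub>0) - k * int n\<bar> < int n)}"
  have far: "\<delta> \<le> 1 - cos (2 * pi * real i * of_int (b - b\<^sub>0) / real n)" if "b \<in> ?E" for b
  proof -
    define y where "y = int i * (b - b\<^sub>0)"
    \<comment> \<open>The nearest multiple puts the angle \<open>2 * pi * \<bar>x\<bar>\<close>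
      between 0 and \<open>pi\<close>, where the cosine decreases.\<close>
    define k where "k = round (real_of_int y / real n)"
    define x where "x = real_of_int y / real n - of_int k"
    have x2: "\<bar>x\<bar> \<le> 1 / 2" unfolding x_def k_def by (metis abs_minus_commute of_int_round_abs_le)
    have "\<not> 100 * \<bar>y - k * int n\<bar> < int n" using that unfolding y_def by blast
    then have "real n \<le> 100 * \<bar>real_of_int (y - k * int n)\<bar>" by linarith
    moreover have "real_of_int (y - k * int n) = x * real n" using n unfolding x_def by (simp add: field_simps)
    ultimately have x1: "1 \<le> 100 * \<bar>x\<bar>" using n by (simp add: abs_mult)
    have "2 * pi * real i * of_int (b - b\<^sub>0) / real n = 2 * pi * x + of_int k * (2 * pi)"
      unfolding x_def y_def by (simp add: algebra_simps)
    then have "cos (2 * pi * real i * of_int (b - b\<^sub>0) / real n) = cos (2 * pi * x)"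
      by (simp add: cos_add cos_int_2pin sin_int_2pin mult.commute[of "of_int k"])
    also have "\<dots> = cos (2 * pi * \<bar>x\<bar>)" by (metis abs_if cos_minus mult_minus_right)
    also have "\<dots> \<le> cos (pi / 50)"
      using x1 x2 pi_gt_zero by (intro cos_monotone_0_pi_le) (auto simp: field_simps)
    finally show ?thesis unfolding \<delta> by simp
  qed
  have "\<delta> * real (card ?E) = (\<Sum>b\<in>?E. \<delta>)" by simp
  also have "\<dots> \<le> (\<Sum>b\<in>?E. 1 - cos (2 * pi * real i * of_int (b - b\<^sub>0) / real n))"
    by (intro sum_mono far)
  also have "\<dots> \<le> (\<Sum>b\<in>B. 1 - cos (2 * pi * real i * of_int (b - b\<^sub>0) / real n))"
    using assms(4) by (intro sum_mono2) auto
  finally have "real (count_mod (int n) Q) * (real n - real (count_mod (int n) Q)) * (\<delta> * real (card ?E))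
      \<le> real n * real r * real (card B)"
    using assms(3) by (intro order_trans[OF _ le] mult_left_mono) auto
  then show ?thesis using i by (intro exI[of _ "int i"] bexI[of _ b\<^sub>0]) auto
qed

section \<open>From a short interval to an arithmetic progression\<close>

text \<open>Subgroups of the integers are cyclic; \<open>m\<close> excludes the trivial one, and the
  least positive element generates.\<close>

lemma additive_closed_eq_multiples:
  fixes H :: "int set"
  assumes "\<And>x y. x \<in> H \<Longrightarrow> y \<in> H \<Longrightarrow> x - y \<in> H" "m \<in> H" "m > 0"
  shows "\<exists>h>0. H = {x. h dvd x}"
proof -
  define h where "h = (LEAST n::nat. n > 0 \<and> int n \<in> H)"
  have ex: "nat m > 0 \<and> int (nat m) \<in> H" using assms(2,3) by simp
  have h: "h > 0" "int h \<in> H" unfolding h_def using LeastI[of "\<lambda>n. n > 0 \<and> int n \<in> H", OF ex] by auto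
  have 0: "0 \<in> H" using assms(1)[OF assms(2,2)] by simp
  have neg: "- x \<in> H" if "x \<in> H" for x using assms(1)[OF 0 that] by simp
  have nat_mult: "int k * x \<in> H" if "x \<in> H" for k x
  proof (induction k)
    case (Suc k)
    then have "int k * x - (- x) \<in> H" using assms(1) neg that by blast
    then show ?case by (simp add: algebra_simps)
  qed (simp add: 0)
  have mult: "k * x \<in> H" if "x \<in> H" for k x
    using nat_mult[OF that, of "nat \<bar>k\<bar>"] neg[of "int (nat \<bar>k\<bar>) * x"] by (cases "k \<ge> 0") auto
  have "int h dvd x" if "x \<in> H" for x
  proof (rule ccontr)
    assume nd: "\<not> int h dvd x"
    have "x - (x div int h) * int h \<in> H" using assms(1) that mult h(2) by blast
    then have "x mod int h \<in> H" by (simp add: minus_div_mult_eq_mod)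
    moreover have "0 \<le> x mod int h" "x mod int h < int h" "x mod int h \<noteq> 0"
      using nd h(1) by (auto simp: dvd_eq_mod_eq_0)
    moreover from this have "nat (x mod int h) > 0" "nat (x mod int h) < h" by linarith+
    ultimately show False
      using not_less_Least[of "nat (x mod int h)" "\<lambda>n. n > 0 \<and> int n \<in> H"] unfolding h_def[symmetric] by simp
  qed
  moreover have "x \<in> H" if "int h dvd x" for x using that mult[OF h(2)] by (auto simp: mult.commute)
  ultimately show ?thesis using h(1) by (intro exI[of _ "int h"]) auto
qed

text \<open>Two translates of \<open>X\<close> inside \<open>H\<close> meet in more than half of \<open>X\<close>, so every difference has many representations.\<close>
lemma differences_closed_if_small:
  assumes "periodic m X" "m > 0" "X \<noteq> {}"
    and H: "H = {x. \<exists>u\<in>X. x + u \<in> X}"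
    and small: "2 * count_mod m H < 3 * count_mod m X"
    and "d \<in> H" "d' \<in> H"
  shows "d - d' \<in> H"
proof -
  have common: "count_mod m X < 2 * count_mod m {u \<in> X. u + d \<in> X}" if d: "d \<in> H" for d
  proof -
    obtain x where x: "x \<in> X" "d + x \<in> X" using d unfolding H by blast
    let ?S = "{u. u + x \<in> X}" and ?T = "{u. u + (d + x) \<in> X}"
    have "?S \<union> ?T \<subseteq> H" using x unfolding H by blast
    then have "count_mod m (?S \<union> ?T) \<le> count_mod m H" by (rule count_mono)
    moreover have "count_mod m ?S = count_mod m X" "count_mod m ?T = count_mod m X"
      using count_shift[OF assms(1,2)] by blast+
    moreover have "?S \<inter> ?T = {u. u + x \<in> {u \<in> X. u + d \<in> X}}" by (auto simp: algebra_simps)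
    moreover have "periodic m {u \<in> X. u + d \<in> X}"
      using assms(1) periodic_shift[OF assms(1), of d] unfolding periodic_def by simp
    ultimately show ?thesis
      using count_Un_Int[of m ?S ?T] count_shift[OF _ assms(2), of "{u \<in> X. u + d \<in> X}" x] small by simp
  qed
  \<comment> \<open>Each of these sets fills more than half of \<open>X\<close>, so they share some
    \<open>u\<close>, and \<open>d - d'\<close> is the difference of \<open>u + d\<close> and
    \<open>u + d'\<close>.\<close>
  let ?S = "{u \<in> X. u + d \<in> X}" and ?T = "{u \<in> X. u + d' \<in> X}"
  have "count_mod m (?S \<union> ?T) \<le> count_mod m X" by (rule count_mono) auto
  then have "count_mod m (?S \<inter> ?T) > 0"
    using count_Un_Int[of m ?S ?T] common[OF assms(6)] common[OF assms(7)] by linarith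
  then have "?S \<inter> ?T \<noteq> {}" unfolding count_mod_def by auto
  then obtain u where "u + d \<in> X" "u + d' \<in> X" by blast
  then show ?thesis unfolding H by (auto intro!: bexI[of _ "u + d'"] simp: algebra_simps)
qed

text \<open>Modulo \<open>M\<close> the points 0 and \<open>M\<close> coincide, and \<open>M\<close>
  itself has defect at most \<open>r\<close>. Moving a difference by \<open>k * M\<close> thus costs
  \<open>r\<close> for each unit of \<open>k\<close>, so several whole periods of the difference set
  \<open>H\<close> lie in one level set. In the conclusion \<open>h\<close> generates
  \<open>H\<close>, and \<open>m\<close> is the number of its classes modulo
  \<open>M\<close>.\<close>

lemma progression_structure:
  assumes "prime p" "periodic p Q" "r \<ge> 1" "finite Z" "Z \<subseteq> {0..M}" "0 \<in> Z" "M \<in> Z" "50 * M < p"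
    "9 * r + 10 \<le> 10 * card Z" "card Z \<le> r + 1"
    and Z: "\<And>z z'. z \<in> Z \<Longrightarrow> z' \<in> Z \<Longrightarrow> defect p Q (z - z') \<le> r"
    and level: "2 * count_mod p {t. defect p Q t \<le> 20 * r} \<le> 100 * r + 2"
  shows "\<exists>h m. h > 0 \<and> m > 0 \<and> M = h * m \<and> (\<forall>z\<in>Z. h dvd z) \<and> 9 * int r \<le> 10 * m \<and> 2 * m \<le> 3 * int r
     \<and> (\<forall>x. 0 \<le> x \<and> x \<le> m \<longrightarrow> defect p Q (h * x) \<le> 2 * r)"
proof -
  have p: "p > 0" using assms(1) prime_gt_0_int by blast
  have M: "M > 0"
  proof (rule ccontr)
    assume "\<not> M > 0"
    then have "Z \<subseteq> {0}" using assms(5) by auto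
    then have "card Z \<le> 1" using card_mono[of "{0}" Z] by simp
    then show False using assms(3,9) by simp
  qed
  define X where "X = {x. x mod M \<in> Z - {M}}"
  have X: "periodic M X" unfolding X_def by (rule periodic_residues)
  have XZ: "X \<inter> {0..<M} = Z - {M}" using assms(5) unfolding X_def by auto
  then have cX: "count_mod M X = card Z - 1" unfolding count_mod_def using assms(7) by simp
  have X_ne: "0 \<in> X" using M assms(6) unfolding X_def by simp
  define H where "H = {x. \<exists>u\<in>X. x + u \<in> X}"
  have H: "periodic M H"
  proof -
    have "x + M + u \<in> X \<longleftrightarrow> x + u \<in> X" for x u
      using periodic_dvd[OF X, of "x + M + u" "x + u"] by simp
    then show ?thesis unfolding H_def periodic_def by simp
  qed
  have rep: "\<exists>u v k. u \<in> Z \<and> v \<in> Z \<and> \<bar>u - v\<bar> < M \<and> x = (u - v) + k * M" if x: "x \<in> H" for x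
  proof -
    obtain u where u: "u \<in> X" "x + u \<in> X" using x unfolding H_def by blast
    have "u mod M \<in> Z" "(x + u) mod M \<in> Z" using u unfolding X_def by blast+
    moreover have "\<bar>(x + u) mod M - u mod M\<bar> < M"
      using pos_mod_bound[OF M, of "x + u"] pos_mod_bound[OF M, of u] pos_mod_sign[OF M, of "x + u"]
        pos_mod_sign[OF M, of u] by linarith
    moreover have "x = ((x + u) mod M - u mod M) + ((x + u) div M - u div M) * M"
      using div_mult_mod_eq[of "x + u" M] div_mult_mod_eq[of u M] by (simp add: algebra_simps)
    ultimately show ?thesis by blast
  qed
  have defM: "defect p Q M \<le> r" using Z[OF assms(7,6)] by simp
  have bound: "defect p Q x \<le> Suc (nat \<bar>k\<bar>) * r" if "u \<in> Z" "v \<in> Z" "x = (u - v) + k * M" for u v k x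
  proof -
    have "defect p Q x \<le> defect p Q (u - v) + defect p Q (k * M)"
      unfolding that(3) by (rule defect_add[OF assms(2) p])
    also have "\<dots> \<le> r + nat \<bar>k\<bar> * r"
      using Z[OF that(1,2)] defect_mult_abs[OF assms(2) p, of k M] mult_le_mono2[OF defM, of "nat \<bar>k\<bar>"] by linarith
    finally show ?thesis by simp
  qed
  have small: "2 * count_mod M H < 3 * count_mod M X"
  proof (rule ccontr)
    assume large: "\<not> ?thesis"
    \<comment> \<open>These 38 periods are distinct modulo \<open>p\<close> since
      \<open>50 * M < p\<close>. If \<open>H\<close> had at least 3/2 of the size of
      \<open>X\<close>, which is at least \<open>9/10 * r\<close>, twice the number of their points
      would be at least \<open>102.6 * r\<close>, above the allowed
      \<open>100 * r + 2\<close>.\<close>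
    let ?W = "H \<inter> {-19 * M..<-19 * M + int 38 * M}"
    have "?W \<subseteq> {t. defect p Q t \<le> 20 * r}"
    proof
      fix x assume x: "x \<in> ?W"
      then obtain u v k where uvk: "u \<in> Z" "v \<in> Z" "\<bar>u - v\<bar> < M" "x = (u - v) + k * M" using rep by blast
      have "-19 * M \<le> x" "x < 19 * M" using x by simp_all
      then have "k * M < 20 * M" "(-20) * M < k * M" using uvk(3,4) by linarith+
      then have "k < 20" "-20 < k" using M by (simp_all only: mult_less_cancel_right_pos)
      then have "Suc (nat \<bar>k\<bar>) * r \<le> 20 * r" by (intro mult_le_mono1) linarith
      then show "x \<in> {t. defect p Q t \<le> 20 * r}"
        unfolding mem_Collect_eq by (rule order_trans[OF bound[OF uvk(1,2,4)]])
    qed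
    moreover have "?W \<subseteq> {-19 * M..<-19 * M + p}" using assms(8) M by fastforce
    ultimately have "card ?W \<le> count_mod p {t. defect p Q t \<le> 20 * r}"
      by (rule card_le_count[OF periodic_defect_le[OF assms(2)] p])
    then have "38 * count_mod M H \<le> count_mod p {t. defect p Q t \<le> 20 * r}"
      using card_periodic_windows[OF H M, of "-19 * M" 38] by simp
    then show False using level large cX assms(3,9) by linarith
  qed
  have sub: "x - y \<in> H" if "x \<in> H" "y \<in> H" for x y
    by (rule differences_closed_if_small[OF X M _ H_def small that]) (use X_ne in auto)
  have ZH: "z \<in> H" if "z \<in> Z" for z
  proof -
    have "z \<in> X"
    proof (cases "z = M")
      case True then show ?thesis using X_ne periodic_mod[OF X, of M] by simp
    next
      case False then show ?thesis using that XZ by blast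
    qed
    then show ?thesis unfolding H_def using X_ne by (auto intro!: bexI[of _ 0])
  qed
  obtain h where h: "h > 0" "H = {x. h dvd x}"
    using additive_closed_eq_multiples[OF sub ZH[OF assms(7)] M] by blast
  have "h dvd M" using ZH[OF assms(7)] h by blast
  then obtain m where m: "M = h * m" by (rule dvdE)
  have m0: "m > 0" using M h(1) m by (simp add: zero_less_mult_iff)
  have cH: "int (count_mod M H) = m"
  proof -
    have "H \<inter> {0..<M} = (\<lambda>x. h * x) ` {0..<m}"
      unfolding h(2) m using h(1) by (auto simp: zero_le_mult_iff)
    moreover have "inj_on (\<lambda>x. h * x) {0..<m}" using h(1) by (auto simp: inj_on_def)
    ultimately show ?thesis unfolding count_mod_def using m0 by (simp add: card_image)
  qed
  have XH: "count_mod M X \<le> count_mod M H" 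
    by (rule count_mono) (use X_ne in \<open>auto simp: H_def intro!: bexI[of _ 0]\<close>)
  \<comment> \<open>Between 0 and \<open>M\<close> the correction \<open>k\<close> is 0 or 1, hence
    the factor 2.\<close>
  have g: "defect p Q (h * x) \<le> 2 * r" if "0 \<le> x" "x \<le> m" for x
  proof -
    have "h * x \<in> H" using h(2) by simp
    then obtain u v k where uvk: "u \<in> Z" "v \<in> Z" "\<bar>u - v\<bar> < M" "h * x = (u - v) + k * M" using rep by blast
    have "0 \<le> h * x" "h * x \<le> M" unfolding m using that h(1) by simp_all
    then have "k * M < 2 * M" "(-1) * M < k * M" using uvk(3,4) by linarith+
    then have "k < 2" "-1 < k" using M by (simp_all only: mult_less_cancel_right_pos)
    then have "Suc (nat \<bar>k\<bar>) * r \<le> 2 * r" by (intro mult_le_mono1) linarith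
    then show ?thesis by (rule order_trans[OF bound[OF uvk(1,2,4)]])
  qed
  have "9 * int r \<le> 10 * m" "2 * m \<le> 3 * int r"
    using XH small cX cH assms(3,9,10) by linarith+
  moreover have "\<forall>z\<in>Z. h dvd z" using ZH h(2) by blast
  ultimately show ?thesis using h(1) m0 m g by blast
qed

text \<open>Division by \<open>m\<close>: up to \<open>k\<close> steps of length \<open>m\<close>
  cost \<open>r\<close> each, and the remainder costs \<open>2 * r\<close>.\<close>

lemma defect_le_on_interval:
  assumes "periodic p Q" "p > 0" "m > 0"
    and g: "\<And>x. 0 \<le> x \<Longrightarrow> x \<le> m \<Longrightarrow> defect p Q x \<le> 2 * r" and gm: "defect p Q m \<le> r"
    and x: "\<bar>x\<bar> \<le> int k * m"
  shows "defect p Q x \<le> (k + 2) * r"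
proof -
  have pos: "defect p Q x \<le> (k + 2) * r" if x: "0 \<le> x" "x \<le> int k * m" for x
  proof -
    have k: "x div m \<le> int k" using x assms(3) by (metis nonzero_mult_div_cancel_right order_less_irrefl zdiv_mono1)
    have "defect p Q (x div m * m + x mod m) \<le> defect p Q (x div m * m) + defect p Q (x mod m)"
      by (rule defect_add[OF assms(1,2)])
    also have "defect p Q (x div m * m) \<le> nat \<bar>x div m\<bar> * defect p Q m"
      by (rule defect_mult_abs[OF assms(1,2)])
    also have "\<dots> \<le> k * r" using k x assms(3) gm by (intro mult_le_mono) (auto simp: pos_imp_zdiv_nonneg_iff)
    also have "defect p Q (x mod m) \<le> 2 * r"
      using assms(3) by (intro g) (auto intro: less_imp_le)
    finally show ?thesis by (simp add: algebra_simps)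
  qed
  show ?thesis
  proof (cases "0 \<le> x")
    case True then show ?thesis using pos[of x] x by simp
  next
    case False then show ?thesis using pos[of "- x"] x defect_minus[OF assms(1,2), of x] by simp
  qed
qed

text \<open>Otherwise the intervals of radius \<open>8 * m\<close> about 0 and \<open>y\<close> are
  disjoint modulo \<open>p\<close>. Their defects are at most \<open>10 * r\<close> and
  \<open>11 * r\<close>, so the level set at \<open>11 * r\<close> has at least
  \<open>32 * m + 2\<close> elements; as \<open>m\<close> is at least \<open>9/10 * r\<close>, this
  exceeds the allowed \<open>27.5 * r + 1\<close>.\<close>

lemma near_if_small_defect:
  assumes "prime p" "periodic p Q" "r \<ge> 1" "m > 0" "9 * int r \<le> 10 * m" "50 * m < p"
    and g: "\<And>x. 0 \<le> x \<Longrightarrow> x \<le> m \<Longrightarrow> defect p Q x \<le> 2 * r" and gm: "defect p Q m \<le> r"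
    and level: "2 * count_mod p {t. defect p Q t \<le> 11 * r} \<le> 55 * r + 2"
    and y: "defect p Q y \<le> r"
  shows "\<exists>y'. \<bar>y'\<bar> \<le> 16 * m \<and> p dvd y - y'"
proof (rule ccontr)
  assume neg: "\<not> ?thesis"
  have p: "p > 0" using assms(1) prime_gt_0_int by blast
  define y\<^sub>1 where "y\<^sub>1 = y mod p"
  have d1: "p dvd y - y\<^sub>1" unfolding y\<^sub>1_def by (rule dvd_minus_mod)
  have d2: "p dvd y - (y\<^sub>1 - p)" using dvd_add[OF d1 dvd_refl[of p]] by (simp add: algebra_simps)
  have y1: "16 * m < y\<^sub>1" "y\<^sub>1 < p - 16 * m"
  proof -
    have "0 \<le> y\<^sub>1" "y\<^sub>1 < p" using p unfolding y\<^sub>1_def by auto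
    moreover have "\<not> \<bar>y\<^sub>1\<bar> \<le> 16 * m" "\<not> \<bar>y\<^sub>1 - p\<bar> \<le> 16 * m" using neg d1 d2 by blast+
    ultimately show "16 * m < y\<^sub>1" "y\<^sub>1 < p - 16 * m" by linarith+
  qed
  have I: "defect p Q x \<le> 10 * r" if "\<bar>x\<bar> \<le> 8 * m" for x
    using defect_le_on_interval[OF assms(2) p assms(4) g gm, of x 8] that by simp
  have gy: "defect p Q y\<^sub>1 \<le> r" using y defect_dvd[OF assms(2) d1] by simp
  have J: "defect p Q x \<le> 11 * r" if "\<bar>x - y\<^sub>1\<bar> \<le> 8 * m" for x
    using defect_add[OF assms(2) p, of y\<^sub>1 "x - y\<^sub>1"] I[OF that] gy by simp
  let ?W = "{- 8 * m..8 * m} \<union> {y\<^sub>1 - 8 * m..y\<^sub>1 + 8 * m}"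
  have "x \<in> {t. defect p Q t \<le> 11 * r}" if "x \<in> ?W" for x
  proof (cases "\<bar>x\<bar> \<le> 8 * m")
    case True then show ?thesis using I[of x] by simp
  next
    case False
    then have "\<bar>x - y\<^sub>1\<bar> \<le> 8 * m" using that by (auto simp: abs_le_iff)
    then show ?thesis using J by blast
  qed
  then have "?W \<subseteq> {t. defect p Q t \<le> 11 * r}" by blast
  moreover have "?W \<subseteq> {- 8 * m..<- 8 * m + p}" using y1 assms(4) by auto
  ultimately have "card ?W \<le> count_mod p {t. defect p Q t \<le> 11 * r}"
    by (rule card_le_count[OF periodic_defect_le[OF assms(2)] p])
  moreover have "card ?W = card {- 8 * m..8 * m} + card {y\<^sub>1 - 8 * m..y\<^sub>1 + 8 * m}"
    using y1 by (intro card_Un_disjoint) auto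
  then have "int (card ?W) = 32 * m + 2" using assms(4) by simp
  ultimately show False using level assms(3,5) by linarith
qed

section \<open>Three translates across a sparse stretch\<close>

text \<open>The sumset of \<open>Q\<close> and three elements; repeating a shift covers pairs and
  single elements.\<close>

definition translates :: "int set \<Rightarrow> int \<Rightarrow> int \<Rightarrow> int \<Rightarrow> int set" where
  "translates Q a b c = {x. x - a \<in> Q \<or> x - b \<in> Q \<or> x - c \<in> Q}"

lemma periodic_translates: "periodic n Q \<Longrightarrow> periodic n (translates Q a b c)"
  using periodic_shift[of n Q "- a"] periodic_shift[of n Q "- b"] periodic_shift[of n Q "- c"]
  unfolding translates_def periodic_def by simp

lemma sum_card_swap:
  assumes "finite X" "finite S"
  shows "(\<Sum>b\<in>X. card {x \<in> S. P x b}) = (\<Sum>x\<in>S. card {b \<in> X. P x b})"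
proof -
  have "(\<Sum>b\<in>X. card {x \<in> S. P x b}) = (\<Sum>b\<in>X. \<Sum>x\<in>S. if P x b then 1 else 0)"
    using assms by (intro sum.cong) (auto simp: sum.If_cases Int_def)
  also have "\<dots> = (\<Sum>x\<in>S. \<Sum>b\<in>X. if P x b then 1 else 0)" by (rule sum.swap)
  also have "\<dots> = (\<Sum>x\<in>S. card {b \<in> X. P x b})"
    using assms by (intro sum.cong) (auto simp: sum.If_cases Int_def)
  finally show ?thesis .
qed

text \<open>For each \<open>x\<close>, injectivity lets at most \<open>card R\<close> of the
  \<open>b\<close> land in \<open>R\<close>. It serves with \<open>R\<close> a set of residues
  modulo \<open>M\<close> and, inside the sparse stretch, with \<open>R\<close> a set of
  integers.\<close>

lemma card_mult_le_sum_escaping: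
  fixes f :: "'a \<Rightarrow> 'b \<Rightarrow> 'c"
  assumes "finite X" "finite S" "finite R" "\<And>x. x \<in> S \<Longrightarrow> inj_on (f x) X"
  shows "card S * card X \<le> (\<Sum>b\<in>X. card {x \<in> S. f x b \<notin> R}) + card S * card R"
proof -
  have "card X \<le> card {b \<in> X. f x b \<notin> R} + card R" if "x \<in> S" for x
  proof -
    have "card {b \<in> X. f x b \<in> R} = card (f x ` {b \<in> X. f x b \<in> R})"
      using assms(4)[OF that] by (intro card_image[symmetric]) (auto intro: inj_on_subset)
    also have "\<dots> \<le> card R" using assms(3) by (intro card_mono) auto
    finally have "card {b \<in> X. f x b \<in> R} \<le> card R" .
    moreover have "card X = card {b \<in> X. f x b \<notin> R} + card {b \<in> X. f x b \<in> R}"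
      using assms(1) by (subst card_Un_disjoint[symmetric]) (auto intro: arg_cong[where f = card])
    ultimately show ?thesis by linarith
  qed
  then have "(\<Sum>x\<in>S. card X) \<le> (\<Sum>x\<in>S. card {b \<in> X. f x b \<notin> R} + card R)" by (rule sum_mono)
  then show ?thesis unfolding sum_card_swap[OF assms(1,2)] by (simp add: sum.distrib)
qed

text \<open>The translate by \<open>M\<close> adds a point in each of the \<open>k\<close> residue classes modulo \<open>M\<close> met by \<open>D\<close>; for \<open>k < r\<close>
  the translate by an average \<open>b\<close> moves at least \<open>\<bar>D\<bar> (r - k) / r \<ge> r - k\<close> points into new classes.\<close>
lemma sum_card_three_translates:
  fixes D X :: "int set"
  assumes "finite D" "M > 0" "X \<subseteq> {0..<M}" "card X = r" "r \<le> card D"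
  shows "r * (card D + r) \<le> (\<Sum>b\<in>X. card (D \<union> (\<lambda>x. x + M) ` D \<union> (\<lambda>x. x + b) ` D))"
proof -
  have fX: "finite X" using assms(3) finite_subset by blast
  define R where "R = (\<lambda>x. x mod M) ` D"
  have fR: "finite R" using assms(1) unfolding R_def by simp
  define T where "T = {x \<in> D. x + M \<notin> D}"
  \<comment> \<open>The largest point of \<open>D\<close> in a class leaves \<open>D\<close> when
    shifted by \<open>M\<close>, so \<open>T\<close> meets every class in \<open>R\<close>.\<close>
  have "R \<subseteq> (\<lambda>x. x mod M) ` T"
  proof
    fix y assume "y \<in> R"
    then obtain x where x: "x \<in> D" "y = x mod M" unfolding R_def by blast
    let ?S = "{z \<in> D. z mod M = y}"
    have S: "finite ?S" "?S \<noteq> {}" using assms(1) x by auto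
    define z where "z = Max ?S"
    have z: "z \<in> ?S" unfolding z_def by (rule Max_in[OF S])
    have "z + M \<notin> D"
    proof
      assume "z + M \<in> D"
      then have "z + M \<le> z" unfolding z_def using z S by (intro Max_ge) (auto simp: z_def[symmetric])
      then show False using assms(2) by simp
    qed
    then show "y \<in> (\<lambda>x. x mod M) ` T" using z unfolding T_def by force
  qed
  then have RT: "card R \<le> card T" using assms(1) surj_card_le[of T R "\<lambda>x. x mod M"] unfolding T_def by simp
  \<comment> \<open>These points move to classes that \<open>D\<close> and its translate by
    \<open>M\<close> both miss, so their images are new.\<close>
  define N where "N b = {x \<in> D. (x + b) mod M \<notin> R}" for b
  have each: "card D + card R + card (N b) \<le> card (D \<union> (\<lambda>x. x + M) ` D \<union> (\<lambda>x. x + b) ` D)" for b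
  proof -
    have fin: "finite T" "finite (N b)" using assms(1) unfolding T_def N_def by auto
    have "D \<inter> (\<lambda>x. x + M) ` T = {}" unfolding T_def by blast
    then have "card (D \<union> (\<lambda>x. x + M) ` T) = card D + card T"
      using assms(1) fin by (subst card_Un_disjoint) (auto simp: card_image)
    moreover have "(D \<union> (\<lambda>x. x + M) ` T) \<inter> (\<lambda>x. x + b) ` N b = {}"
    proof -
      have "y mod M \<in> R" if "y \<in> D \<union> (\<lambda>x. x + M) ` T" for y
        using that unfolding R_def T_def by auto
      moreover have "y mod M \<notin> R" if "y \<in> (\<lambda>x. x + b) ` N b" for y
        using that unfolding N_def by auto
      ultimately show ?thesis by (meson disjoint_iff)
    qed
    then have "card ((D \<union> (\<lambda>x. x + M) ` T) \<union> (\<lambda>x. x + b) ` N b)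
        = card (D \<union> (\<lambda>x. x + M) ` T) + card (N b)"
      using assms(1) fin by (subst card_Un_disjoint) (auto simp: card_image)
    moreover have "card ((D \<union> (\<lambda>x. x + M) ` T) \<union> (\<lambda>x. x + b) ` N b)
        \<le> card (D \<union> (\<lambda>x. x + M) ` D \<union> (\<lambda>x. x + b) ` D)"
      using assms(1) unfolding T_def N_def by (intro card_mono) auto
    ultimately show ?thesis using RT by linarith
  qed
  have "card D * card X \<le> (\<Sum>b\<in>X. card (N b)) + card D * card R"
    unfolding N_def
  proof (rule card_mult_le_sum_escaping[OF fX assms(1) fR])
    fix x
    show "inj_on (\<lambda>b. (x + b) mod M) X"
    proof (rule inj_onI)
      fix b b' assume b: "b \<in> X" "b' \<in> X" "(x + b) mod M = (x + b') mod M"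
      then have "M dvd b - b'" by (simp add: mod_eq_dvd_iff)
      then have "b mod M = b' mod M" by (simp only: mod_eq_dvd_iff)
      moreover have "b mod M = b" "b' mod M = b'" using b assms(3) by auto
      ultimately show "b = b'" by metis
    qed
  qed
  moreover have "r * r \<le> r * card R + (card D * r - card D * card R)"
  proof (cases "r \<le> card R")
    case True then show ?thesis by (simp add: trans_le_add1)
  next
    case False
    then have "r * (r - card R) \<le> card D * (r - card R)" using assms(5) by (intro mult_le_mono1) auto
    then have "r * r - r * card R \<le> card D * r - card D * card R" unfolding diff_mult_distrib2 .
    then show ?thesis by linarith
  qed
  ultimately have "r * r \<le> r * card R + (\<Sum>b\<in>X. card (N b))" unfolding assms(4) by linarith
  moreover have "(\<Sum>b\<in>X. card D + card R + card (N b)) \<le> (\<Sum>b\<in>X. card (D \<union> (\<lambda>x. x + M) ` D \<union> (\<lambda>x. x + b) ` D))"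
    by (intro sum_mono each)
  ultimately show ?thesis using assms(4) by (simp add: sum.distrib algebra_simps)
qed

text \<open>Cutting the circle at the sparse stretch from \<open>u - M\<close> to \<open>v\<close>: the points of \<open>Q\<close> just before \<open>u\<close>
  are given up, and the translates by \<open>0\<close> and \<open>b\<close> of the other points of the stretch make up for the loss.\<close>
lemma three_translates_right:
  assumes "periodic p Q" "p > 0" "Y \<subseteq> {0..M}" "M \<in> Y" "M > 0" "card Y = r + 1" "r \<ge> 1"
    "u \<le> v - M" "v \<le> u + p - M" "4 * card (Q \<inter> {u - M..<v}) \<le> r"
    "2 * card (Q \<inter> {u - M..<u}) \<le> card (Q \<inter> {u..<v - M})" "2 * r \<le> count_mod p Q"
  shows "\<exists>b\<in>Y. count_mod p Q + r \<le> count_mod p (translates Q 0 M b)"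
proof -
  define X where "X = Y - {M}"
  have fY: "finite Y" using assms(3) finite_subset by blast
  have X: "finite X" "X \<subseteq> {0..<M}" "card X = r" using assms(3,4,6) fY unfolding X_def by auto
  \<comment> \<open>The window of length \<open>p\<close> from \<open>u\<close> is split.
    \<open>E\<close> is the rest of the stretch, kept by the translate by 0, and points of
    \<open>E\<^sub>0\<close> stay below \<open>v\<close> when shifted by less than \<open>M\<close>.
    \<open>D\<close> ends \<open>M\<close> before the window, so its translates stay inside. The
    last \<open>q\<close> points, congruent to those just before \<open>u\<close>, are given
    up.\<close>
  define D where "D = Q \<inter> {v..<u + p - M}"
  define E where "E = Q \<inter> {u..<v}"
  define E\<^sub>0 where "E\<^sub>0 = Q \<inter> {u..<v - M}"
  define q where "q = card (Q \<inter> {u - M..<u})"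
  have fin: "finite D" "finite E" "finite E\<^sub>0" unfolding D_def E_def E\<^sub>0_def by auto
  have cW: "card (Q \<inter> {u + p - M..<u + p}) = q"
  proof -
    have shift: "x + p \<in> Q \<longleftrightarrow> x \<in> Q" "x - p \<in> Q \<longleftrightarrow> x \<in> Q" for x
      using assms(1) periodic_dvd[OF assms(1), of "x - p" x] unfolding periodic_def by auto
    show ?thesis unfolding q_def
      by (rule bij_betw_same_card[where f = "\<lambda>x. x - p"], rule bij_betwI[where g = "\<lambda>x. x + p"])
        (auto simp: shift)
  qed
  have cQ: "count_mod p Q = card D + card E + q"
  proof -
    have "Q \<inter> {u..<u + p} = (E \<union> D) \<union> (Q \<inter> {u + p - M..<u + p})"
      using assms(5,8,9) unfolding D_def E_def by auto
    then have "count_mod p Q = card ((E \<union> D) \<union> (Q \<inter> {u + p - M..<u + p}))"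
      using card_periodic_window[OF assms(1,2), of u] by simp
    also have "\<dots> = card (E \<union> D) + card (Q \<inter> {u + p - M..<u + p})"
      using assms(5,8,9) unfolding D_def E_def by (intro card_Un_disjoint) auto
    also have "card (E \<union> D) = card E + card D"
      unfolding D_def E_def by (intro card_Un_disjoint) auto
    finally show ?thesis using cW by simp
  qed
  have Eq: "4 * (card E + q) \<le> r"
  proof -
    have "Q \<inter> {u - M..<v} = (Q \<inter> {u - M..<u}) \<union> E" using assms(5,8) unfolding E_def by auto
    then have "card (Q \<inter> {u - M..<v}) = q + card E"
      unfolding q_def E_def by (simp, intro card_Un_disjoint) auto
    then show ?thesis using assms(10) by simp
  qed
  have D: "r \<le> card D" using assms(12) cQ Eq by presburger
  let ?D = "\<lambda>b. D \<union> (\<lambda>x. x + M) ` D \<union> (\<lambda>x. x + b) ` D"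
  let ?N = "\<lambda>b. {x \<in> E\<^sub>0. x + b \<notin> E}"
  have each: "card (?D b) + card E + card (?N b) \<le> count_mod p (translates Q 0 M b)" if b: "b \<in> X" for b
  proof -
    have b0: "0 \<le> b" "b < M" using b X(2) by auto
    have "card (?D b) + card E + card (?N b) = card (?D b \<union> (E \<union> (\<lambda>x. x + b) ` ?N b))"
    proof -
      have "card (E \<union> (\<lambda>x. x + b) ` ?N b) = card E + card (?N b)"
        using fin by (subst card_Un_disjoint) (auto simp: card_image)
      moreover have "card (?D b \<union> (E \<union> (\<lambda>x. x + b) ` ?N b)) = card (?D b) + card (E \<union> (\<lambda>x. x + b) ` ?N b)"
      proof (rule card_Un_disjoint)
        have "x \<ge> v" if "x \<in> ?D b" for x using that b0 assms(5) unfolding D_def by auto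
        moreover have "x < v" if "x \<in> E \<union> (\<lambda>x. x + b) ` ?N b" for x
          using that b0 unfolding E_def E\<^sub>0_def by auto
        ultimately show "?D b \<inter> (E \<union> (\<lambda>x. x + b) ` ?N b) = {}" by (meson disjoint_iff not_le)
      qed (use fin in auto)
      ultimately show ?thesis by simp
    qed
    also have "\<dots> \<le> count_mod p (translates Q 0 M b)"
    proof (rule card_le_count[OF periodic_translates[OF assms(1)] assms(2)])
      show "?D b \<union> (E \<union> (\<lambda>x. x + b) ` ?N b) \<subseteq> translates Q 0 M b"
        unfolding D_def E_def E\<^sub>0_def translates_def by auto
      show "?D b \<union> (E \<union> (\<lambda>x. x + b) ` ?N b) \<subseteq> {u..<u + p}"
        using b0 assms(5,8,9) unfolding D_def E_def E\<^sub>0_def by auto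
    qed
    finally show ?thesis .
  qed
  \<comment> \<open>At most \<open>card E\<close>, hence at most \<open>r / 4\<close>, of the
    \<open>b\<close> send a given point of \<open>E\<^sub>0\<close> into \<open>E\<close>. So the
    sum is at least \<open>3/4 * r * card E\<^sub>0\<close>, and \<open>card E\<^sub>0\<close> is at
    least \<open>2 * q\<close>.\<close>
  have gain: "r * q \<le> (\<Sum>b\<in>X. card (?N b))"
  proof -
    have "card E\<^sub>0 * r \<le> (\<Sum>b\<in>X. card (?N b)) + card E\<^sub>0 * card E"
      using card_mult_le_sum_escaping[OF X(1) fin(3,2), of "\<lambda>x b. x + b"] X(3) by (simp add: inj_on_def)
    moreover have "4 * (card E\<^sub>0 * card E) \<le> card E\<^sub>0 * r"
      using mult_le_mono2[of "4 * card E" r "card E\<^sub>0"] Eq by (simp add: mult.left_commute)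
    moreover have "2 * (r * q) \<le> card E\<^sub>0 * r"
      using mult_le_mono1[of "2 * q" "card E\<^sub>0" r] assms(11) unfolding q_def E\<^sub>0_def by (simp add: ac_simps)
    ultimately show ?thesis by linarith
  qed
  have "r * (card D + r) + r * card E + r * q \<le> (\<Sum>b\<in>X. card (?D b) + card E + card (?N b))"
    using sum_card_three_translates[OF fin(1) assms(5) X(2,3) D] gain X(3) by (simp add: sum.distrib)
  also have "\<dots> \<le> (\<Sum>b\<in>X. count_mod p (translates Q 0 M b))" by (intro sum_mono each)
  finally have le: "r * (count_mod p Q + r) \<le> (\<Sum>b\<in>X. count_mod p (translates Q 0 M b))"
    unfolding cQ by (simp add: algebra_simps)
  have "\<exists>b\<in>X. count_mod p Q + r \<le> count_mod p (translates Q 0 M b)"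
  proof (rule ccontr)
    assume "\<not> ?thesis"
    then have "(\<Sum>b\<in>X. count_mod p (translates Q 0 M b)) < (\<Sum>b\<in>X. count_mod p Q + r)"
      using X assms(7) by (intro sum_strict_mono) auto
    then show False using le X(3) by simp
  qed
  then show ?thesis unfolding X_def by blast
qed

lemma card_reflect:
  fixes Q :: "int set"
  shows "card ({x. - x \<in> Q} \<inter> {a..<b}) = card (Q \<inter> {1 - b..<1 - a})"
  by (rule bij_betw_same_card[where f = uminus], rule bij_betwI[where g = uminus]) auto

lemma count_reflect:
  assumes "periodic n Q" "n > 0" shows "count_mod n {x. - x \<in> Q} = count_mod n Q"
  using card_reflect[of Q 0 n] card_periodic_window[OF assms, of "1 - n"] unfolding count_mod_def by simp

text \<open>The mirror image of \<open>three_translates_right\<close> under negation, with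
  \<open>M - y\<close> in place of each \<open>y\<close> in \<open>Y\<close>; the sacrificed block
  now starts at \<open>u\<close>.\<close>

lemma three_translates_left:
  assumes "periodic p Q" "p > 0" "Y \<subseteq> {0..M}" "0 \<in> Y" "M > 0" "card Y = r + 1" "r \<ge> 1"
    "v \<le> u - M" "u + M - p \<le> v" "4 * card (Q \<inter> {v..<u + M}) \<le> r"
    "2 * card (Q \<inter> {u..<u + M}) \<le> card (Q \<inter> {v + M..<u})" "2 * r \<le> count_mod p Q"
  shows "\<exists>b\<in>Y. count_mod p Q + r \<le> count_mod p (translates Q 0 M b)"
proof -
  let ?Q = "{x. - x \<in> Q}" and ?Y = "(\<lambda>y. M - y) ` Y"
  have per: "periodic p ?Q" by (rule periodic_uminus[OF assms(1)])
  have "card ?Y = r + 1" using assms(6) by (simp add: card_image inj_on_def)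
  moreover have "?Y \<subseteq> {0..M}" "M \<in> ?Y" using assms(3,4) by force+
  ultimately have "\<exists>b\<in>?Y. count_mod p ?Q + r \<le> count_mod p (translates ?Q 0 M b)"
    using assms(5,7-) by (intro three_translates_right[OF per assms(2), where u = "1 - u" and v = "1 - v"])
      (auto simp: card_reflect count_reflect[OF assms(1,2)])
  then obtain b where b: "b \<in> Y" "count_mod p Q + r \<le> count_mod p (translates ?Q 0 M (M - b))"
    using count_reflect[OF assms(1,2)] by auto
  let ?T = "translates Q 0 M b"
  have T: "periodic p ?T" by (rule periodic_translates[OF assms(1)])
  have "translates ?Q 0 M (M - b) = {x. - x \<in> {x. x + M \<in> ?T}}"
    unfolding translates_def by (auto simp: algebra_simps)
  then have "count_mod p (translates ?Q 0 M (M - b)) = count_mod p ?T"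
    using count_reflect[OF periodic_shift[OF T] assms(2)] count_shift[OF T assms(2)] by simp
  then show ?thesis using b by auto
qed

text \<open>Of seven blocks of length \<open>M\<close> the sparsest is sacrificed. On one side of it
  there remain two whole blocks, with at least twice as many points, and a margin of
  \<open>M\<close> up to the end of the stretch.\<close>

lemma three_translates_if_sparse:
  assumes "periodic p Q" "p > 0" "Y \<subseteq> {0..M}" "0 \<in> Y" "M \<in> Y" "M > 0" "card Y = r + 1" "r \<ge> 1"
    "7 * M \<le> p" "4 * card (Q \<inter> {z..<z + 7 * M}) \<le> r" "2 * r \<le> count_mod p Q"
  shows "\<exists>b\<in>Y. count_mod p Q + r \<le> count_mod p (translates Q 0 M b)"
proof -
  define w where "w i = card (Q \<inter> {z + int i * M..<z + int (Suc i) * M})" for i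
  obtain i where i: "i \<in> {..<7}" "\<forall>j\<in>{..<7}. w i \<le> w j"
    using ex_is_arg_min_if_finite[of "{..<7::nat}" w]
    unfolding is_arg_min_linorder by (metis finite_lessThan lessThan_iff empty_iff zero_less_numeral)
  have two: "2 * w i \<le> card (Q \<inter> {a..<b})"
    if j: "Suc j < 7" "a \<le> z + int j * M" "z + int (Suc (Suc j)) * M \<le> b" for j a b
  proof -
    have "w j + w (Suc j) = card ((Q \<inter> {z + int j * M..<z + int (Suc j) * M})
        \<union> (Q \<inter> {z + int (Suc j) * M..<z + int (Suc (Suc j)) * M}))"
      unfolding w_def by (intro card_Un_disjoint[symmetric]) auto
    also have "\<dots> \<le> card (Q \<inter> {a..<b})"
      using j(2,3) assms(6) by (intro card_mono) (auto simp: algebra_simps)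
    finally have "w j + w (Suc j) \<le> card (Q \<inter> {a..<b})" .
    moreover have "w i \<le> w j" "w i \<le> w (Suc j)" using i(2) j(1) by auto
    ultimately show ?thesis by linarith
  qed
  show ?thesis
  proof (cases "i \<le> 3")
    case True
    have iM: "int i * M \<le> 3 * M" "0 \<le> int i * M" using True assms(6) by simp_all
    define u where "u = z + int i * M + M"
    have u: "z + int (Suc i) * M = u" "z + int i * M = u - M" "z + int (Suc (Suc (Suc i))) * M = u + 2 * M"
      unfolding u_def by (simp_all add: algebra_simps)
    show ?thesis
    proof (rule three_translates_right[OF assms(1,2,3,5,6,7,8)])
      show "u \<le> z + 7 * M - M" "z + 7 * M \<le> u + p - M" using iM assms(6,9) unfolding u_def by linarith+
      have "card (Q \<inter> {u - M..<z + 7 * M}) \<le> card (Q \<inter> {z..<z + 7 * M})"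
        using iM unfolding u_def by (intro card_mono) auto
      then show "4 * card (Q \<inter> {u - M..<z + 7 * M}) \<le> r" using assms(10) by linarith
      have "2 * w i \<le> card (Q \<inter> {u..<z + 7 * M - M})"
        using two[of "Suc i" u "z + 7 * M - M"] True iM unfolding u by (simp add: u_def)
      then show "2 * card (Q \<inter> {u - M..<u}) \<le> card (Q \<inter> {u..<z + 7 * M - M})" unfolding w_def u .
    qed (rule assms(11))
  next
    case False
    have "int 4 * M \<le> int i * M" "int i * M \<le> int 6 * M"
      using False i(1) assms(6) by (intro mult_right_mono; simp)+
    then have iM: "4 * M \<le> int i * M" "int i * M \<le> 6 * M" by simp_all
    define u where "u = z + int i * M"
    have u: "z + int (Suc i) * M = u + M" "z + int i * M = u" unfolding u_def by (simp_all add: algebra_simps)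
    show ?thesis
    proof (rule three_translates_left[OF assms(1-4,6-8)])
      show "z \<le> u - M" "u + M - p \<le> z" using iM assms(6,9) unfolding u_def by linarith+
      have "card (Q \<inter> {z..<u + M}) \<le> card (Q \<inter> {z..<z + 7 * M})"
        using iM unfolding u_def by (intro card_mono) auto
      then show "4 * card (Q \<inter> {z..<u + M}) \<le> r" using assms(10) by linarith
      have "2 * w i \<le> card (Q \<inter> {z + M..<u})"
        using two[of 1 "z + M" u] iM assms(6) by (simp add: u_def)
      then show "2 * card (Q \<inter> {u..<u + M}) \<le> card (Q \<inter> {z + M..<u})" unfolding w_def u .
    qed (rule assms(11))
  qed
qed

text \<open>Average over the windows that start outside \<open>Q\<close>: for an offset
  \<open>x\<close> the starts \<open>a\<close> with \<open>a + x\<close> in \<open>Q\<close> are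
  counted by the defect of the complement at \<open>x\<close>.\<close>

lemma exists_sparse_window:
  assumes "periodic p Q" "p > 0" "\<And>x. 0 \<le> x \<Longrightarrow> x < int L \<Longrightarrow> defect p Q x \<le> K"
    "4 * int L * int K < (p - int (count_mod p Q)) * int r"
  shows "\<exists>z. 4 * card (Q \<inter> {z..<z + int L}) \<le> r"
proof (rule ccontr)
  assume neg: "\<not> ?thesis"
  let ?A = "- Q \<inter> {0..<p}"
  have eq: "card {x \<in> {0..<int L}. a + x \<in> Q} = card (Q \<inter> {a..<a + int L})" for a
    by (rule bij_betw_same_card[where f = "\<lambda>x. a + x"], rule bij_betwI[where g = "\<lambda>x. x - a"]) auto
  have "card ?A * r = (\<Sum>a\<in>?A. r)" by simp
  also have "\<dots> \<le> (\<Sum>a\<in>?A. 4 * card (Q \<inter> {a..<a + int L}))"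
    using neg by (intro sum_mono) (meson less_imp_le not_le)
  also have "\<dots> = 4 * (\<Sum>a\<in>?A. card {x \<in> {0..<int L}. a + x \<in> Q})" unfolding eq by (simp add: sum_distrib_left)
  also have "(\<Sum>a\<in>?A. card {x \<in> {0..<int L}. a + x \<in> Q}) = (\<Sum>x\<in>{0..<int L}. card {a \<in> ?A. a + x \<in> Q})"
    by (rule sum_card_swap) auto
  also have "\<dots> \<le> (\<Sum>x\<in>{0..<int L}. K)"
  proof (rule sum_mono)
    fix x assume x: "x \<in> {0..<int L}"
    have "{a \<in> ?A. a + x \<in> Q} = {a \<in> - Q. a + x \<notin> - Q} \<inter> {0..<p}" by auto
    then have "card {a \<in> ?A. a + x \<in> Q} = defect p (- Q) x" unfolding defect_def count_mod_def by simp
    then show "card {a \<in> ?A. a + x \<in> Q} \<le> K" using defect_Compl[OF assms(1,2)] assms(3) x by simp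
  qed
  also have "\<dots> = L * K" by simp
  finally have "card ?A * r \<le> 4 * (L * K)" by simp
  then have "int (card ?A) * int r \<le> 4 * int L * int K" by (metis (no_types, lifting) mult.assoc of_nat_mult of_nat_le_iff of_nat_numeral)
  moreover have "int (card ?A) = p - int (count_mod p Q)" using count_Compl[OF assms(2), of Q] unfolding count_mod_def .
  ultimately show False using assms(4) by simp
qed

section \<open>Pairs of translates and affine changes of coordinates\<close>

text \<open>Inclusion-exclusion. The case \<open>b = b'\<close> also covers a set \<open>B\<close>
  with one element.\<close>

lemma count_translates_pair:
  assumes "periodic n Q" "n > 0"
  shows "count_mod n (translates Q b b' b') = count_mod n Q + defect n Q (b - b')"
proof -
  let ?S = "{x. x + - b \<in> Q}" and ?T = "{x. x + - b' \<in> Q}" and ?C = "{x \<in> Q. x + (b - b') \<in> Q}"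
  have "periodic n ?C"
    using assms(1) periodic_shift[OF assms(1), of "b - b'"] unfolding periodic_def by simp
  moreover have "?S \<inter> ?T = {x. x + - b \<in> ?C}" by auto
  ultimately have "count_mod n (?S \<inter> ?T) = count_mod n ?C" using count_shift[OF _ assms(2), of ?C "- b"] by simp
  moreover have "translates Q b b' b' = ?S \<union> ?T" unfolding translates_def by auto
  ultimately show ?thesis
    using count_Un_Int[of n ?S ?T] count_shift[OF assms, of "- b"] count_shift[OF assms, of "- b'"]
      defect_eq[OF assms, of "b - b'"] by simp
qed

text \<open>The map from \<open>x\<close> to \<open>e * x + d\<close> carries translates of the
  rescaled set to translates of \<open>Q\<close>, so the shifts may be normalized to small
  integers.\<close>

lemma count_translates_affine:
  assumes "prime p" "periodic p Q" "\<not> p dvd e"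
    "p dvd a - (d + e * a')" "p dvd b - (d + e * b')" "p dvd c - (d + e * c')"
  shows "count_mod p (translates {x. e * x \<in> Q} a' b' c') = count_mod p (translates Q a b c)"
proof -
  have p: "p > 0" using assms(1) prime_gt_0_int by blast
  let ?T = "translates Q a b c"
  have T: "periodic p ?T" by (rule periodic_translates[OF assms(2)])
  have "e * (x - a') \<in> Q \<longleftrightarrow> (e * x + d) - a \<in> Q" if "p dvd a - (d + e * a')" for a a' x
    by (rule periodic_dvd[OF assms(2)]) (use that in \<open>simp add: algebra_simps\<close>)
  note iff = this[OF assms(4)] this[OF assms(5)] this[OF assms(6)]
  have "translates {x. e * x \<in> Q} a' b' c' = {x. e * x \<in> {x. x + d \<in> ?T}}"
    unfolding translates_def mem_Collect_eq iff ..
  then show ?thesis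
    using count_scale[OF periodic_shift[OF T, of d] assms(1,3)] count_shift[OF T p, of d] by simp
qed

lemma exists_inverse_mod:
  fixes p e :: int
  assumes "prime p" "\<not> p dvd e"
  shows "\<exists>e'. p dvd e * e' - 1 \<and> \<not> p dvd e'"
proof -
  have "coprime e p" using assms by (metis coprime_commute prime_imp_coprime)
  then obtain e' where "[e * e' = 1] (mod p)" using cong_solve_coprime_int by blast
  then have e': "p dvd e * e' - 1" by (simp add: cong_iff_dvd_diff)
  moreover have "\<not> p dvd e'"
  proof
    assume "p dvd e'"
    then have "p dvd e * e'" by simp
    then have "p dvd e * e' - (e * e' - 1)" using e' by (rule dvd_diff)
    then show False using assms(1) by (simp add: not_prime_unit)
  qed
  ultimately show ?thesis by blast
qed

section \<open>Locating B and assembling the bound\<close>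

text \<open>The conclusion speaks only of \<open>defect\<close> along the progression, no longer of
  the part of \<open>B\<close> that produced it, so that all elements of \<open>B\<close> can then
  be located on equal terms.\<close>

lemma exists_progression:
  fixes C :: real
  assumes "prime p" "p = int n" "periodic p Q" "B \<subseteq> {0..<p}" "card B = r + 1" "r \<ge> 1"
    and small: "\<And>b b'. b \<in> B \<Longrightarrow> b' \<in> B \<Longrightarrow> defect p Q (b - b') \<le> r"
    and C: "C \<ge> 40 / (1 - cos (pi / 50))" "C \<ge> 800"
    and sz: "C * real r \<le> real (count_mod p Q)" "C * real r \<le> real n - real (count_mod p Q)"
  shows "\<exists>e m. \<not> p dvd e \<and> m > 0 \<and> 50 * m < p \<and> 9 * int r \<le> 10 * m \<and> 2 * m \<le> 3 * int r
    \<and> (\<forall>x. 0 \<le> x \<and> x \<le> m \<longrightarrow> defect p Q (e * x) \<le> 2 * r) \<and> defect p Q (e * m) \<le> r"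
proof -
  define \<delta> :: real where "\<delta> = 1 - cos (pi / 50)"
  define a where "a = real (count_mod p Q)"
  have "cos (pi / 50) < cos 0" by (rule cos_monotone_0_pi) (auto simp: field_simps)
  then have \<delta>: "\<delta> > 0" unfolding \<delta>_def by simp
  have p: "p > 0" using assms(1) prime_gt_0_int by blast
  have fB: "finite B" using assms(4) finite_subset by blast
  have Bne: "B \<noteq> {}" using assms(5) by auto
  have r: "real r \<ge> 1" using assms(6) by simp
  have Cr: "800 * real r \<le> C * real r" using C(2) by (intro mult_right_mono) auto
  have a: "C * real r \<le> a" "C * real r \<le> real n - a" "a > 0" "a < real n"
    using sz Cr r unfolding a_def by linarith+
  obtain \<xi> b\<^sub>0 where \<xi>: "b\<^sub>0 \<in> B" "0 < \<xi>" "\<xi> < p"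
    and E: "a * (real n - a) * (\<delta> * real (card {b \<in> B. \<not> (\<exists>k. 100 * \<bar>\<xi> * (b - b\<^sub>0) - k * p\<bar> < p)}))
      \<le> real n * real r * real (card B)"
    using concentration[of n Q B r \<delta>] assms(3) fB Bne small a(3,4) \<delta>_def
    unfolding a_def assms(2) by auto
  define B\<^sub>1 where "B\<^sub>1 = {b \<in> B. \<exists>k. 100 * \<bar>\<xi> * (b - b\<^sub>0) - k * p\<bar> < p}"
  define s where "s = card {b \<in> B. \<not> (\<exists>k. 100 * \<bar>\<xi> * (b - b\<^sub>0) - k * p\<bar> < p)}"
  have "B = B\<^sub>1 \<union> {b \<in> B. \<not> (\<exists>k. 100 * \<bar>\<xi> * (b - b\<^sub>0) - k * p\<bar> < p)}" unfolding B\<^sub>1_def by blast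
  moreover have "B\<^sub>1 \<inter> {b \<in> B. \<not> (\<exists>k. 100 * \<bar>\<xi> * (b - b\<^sub>0) - k * p\<bar> < p)} = {}" unfolding B\<^sub>1_def by blast
  ultimately have cB: "card B = card B\<^sub>1 + s"
    unfolding s_def using card_Un_disjoint[of B\<^sub>1 "{b \<in> B. \<not> (\<exists>k. 100 * \<bar>\<xi> * (b - b\<^sub>0) - k * p\<bar> < p)}"] fB
    unfolding B\<^sub>1_def by simp
  \<comment> \<open>The larger of \<open>a\<close> and \<open>n - a\<close> is at least
    \<open>n / 2\<close>, the smaller at least \<open>C * r\<close>. With
    \<open>card B \<le> 2 * r\<close> and \<open>C * \<delta> \<ge> 40\<close> at most a tenth of
    \<open>r\<close> elements are exceptional.\<close>
  have s: "10 * s \<le> r"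
  proof -
    have "real n * (C * real r) \<le> 2 * (a * (real n - a))"
    proof (cases "2 * a \<le> real n")
      case True
      have "(C * real r) * real n \<le> a * (2 * (real n - a))"
        using a True by (intro mult_mono) auto
      then show ?thesis by (simp add: algebra_simps)
    next
      case False
      have "real n * (C * real r) \<le> (2 * a) * (real n - a)"
        using a False Cr r by (intro mult_mono) auto
      then show ?thesis by (simp add: algebra_simps)
    qed
    then have "real n * (C * real r) * (\<delta> * real s) \<le> 2 * (a * (real n - a)) * (\<delta> * real s)"
      using \<delta> by (intro mult_right_mono) auto
    also have "\<dots> \<le> 2 * (real n * real r * real (card B))" using E unfolding s_def by simp
    also have "\<dots> = real n * real r * (2 * real (card B))" by simp
    also have "\<dots> \<le> real n * real r * (4 * real r)" using assms(5) r by (intro mult_left_mono) auto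
    finally have "real n * real r * (C * \<delta> * real s) \<le> real n * real r * (4 * real r)" by (simp only: mult_ac)
    then have "C * \<delta> * real s \<le> 4 * real r" using a r by simp
    moreover have "40 \<le> C * \<delta>" using C(1) \<delta> unfolding \<delta>_def[symmetric] by (simp add: field_simps)
    then have "40 * real s \<le> C * \<delta> * real s" by (intro mult_right_mono) auto
    ultimately show ?thesis by linarith
  qed
  \<comment> \<open>The dilation is undone by \<open>\<xi>'\<close>: differences of the small
    integers \<open>y b\<close>, multiplied by \<open>\<xi>'\<close>, are the differences in
    \<open>B\<close> modulo \<open>p\<close>.\<close>
  have "\<not> p dvd \<xi>" using \<xi> zdvd_not_zless by blast
  then obtain \<xi>' where \<xi>': "p dvd \<xi> * \<xi>' - 1" "\<not> p dvd \<xi>'" using exists_inverse_mod[OF assms(1)] by blast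
  have "\<forall>b\<in>B\<^sub>1. \<exists>y. 100 * \<bar>y\<bar> < p \<and> p dvd y - \<xi> * (b - b\<^sub>0)"
  proof
    fix b assume "b \<in> B\<^sub>1"
    then obtain k where "100 * \<bar>\<xi> * (b - b\<^sub>0) - k * p\<bar> < p" unfolding B\<^sub>1_def by blast
    then show "\<exists>y. 100 * \<bar>y\<bar> < p \<and> p dvd y - \<xi> * (b - b\<^sub>0)"
      by (intro exI[of _ "\<xi> * (b - b\<^sub>0) - k * p"]) simp
  qed
  then obtain y where y: "\<And>b. b \<in> B\<^sub>1 \<Longrightarrow> 100 * \<bar>y b\<bar> < p" "\<And>b. b \<in> B\<^sub>1 \<Longrightarrow> p dvd y b - \<xi> * (b - b\<^sub>0)"
    by metis
  have yy: "p dvd \<xi>' * (y b - y b') - (b - b')" if "b \<in> B\<^sub>1" "b' \<in> B\<^sub>1" for b b'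
  proof -
    have "p dvd \<xi>' * ((y b - \<xi> * (b - b\<^sub>0)) - (y b' - \<xi> * (b' - b\<^sub>0))) + (\<xi> * \<xi>' - 1) * (b - b')"
      by (rule dvd_add[OF dvd_mult[OF dvd_diff[OF y(2)[OF that(1)] y(2)[OF that(2)]]] dvd_mult2[OF \<xi>'(1)]])
    then show ?thesis by (simp add: algebra_simps)
  qed
  have inj: "inj_on y B\<^sub>1"
  proof (rule inj_onI)
    fix b b' assume b: "b \<in> B\<^sub>1" "b' \<in> B\<^sub>1" "y b = y b'"
    then have "p dvd b' - b" using yy[of b b'] by simp
    then have "b' mod p = b mod p" by (simp add: mod_eq_dvd_iff)
    moreover have "b' mod p = b'" "b mod p = b" using b assms(4) unfolding B\<^sub>1_def by auto
    ultimately show "b = b'" by metis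
  qed
  have fB1: "finite B\<^sub>1" using fB unfolding B\<^sub>1_def by simp
  have B1ne: "B\<^sub>1 \<noteq> {}" using cB assms(5) s by auto
  define l where "l = Min (y ` B\<^sub>1)"
  define M where "M = Max (y ` B\<^sub>1) - l"
  define Z where "Z = (\<lambda>z. z - l) ` y ` B\<^sub>1"
  have fin: "finite (y ` B\<^sub>1)" "y ` B\<^sub>1 \<noteq> {}" using fB1 B1ne by auto
  obtain b' b'' where ends: "b' \<in> B\<^sub>1" "l = y b'" "b'' \<in> B\<^sub>1" "Max (y ` B\<^sub>1) = y b''"
    using Min_in[OF fin] Max_in[OF fin] unfolding l_def by auto
  have Z0: "0 \<in> Z" "M \<in> Z" "50 * M < p"
    using ends y(1)[OF ends(1)] y(1)[OF ends(3)] unfolding Z_def M_def by auto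
  have ZM: "Z \<subseteq> {0..M}" unfolding Z_def M_def l_def using fin by auto
  have cZ: "card Z = card B\<^sub>1" unfolding Z_def using inj by (simp add: card_image)
  define Q\<^sub>1 where "Q\<^sub>1 = {x. \<xi>' * x \<in> Q}"
  have Q1: "periodic p Q\<^sub>1" "count_mod p Q\<^sub>1 = count_mod p Q" "\<And>t. defect p Q\<^sub>1 t = defect p Q (\<xi>' * t)"
    unfolding Q\<^sub>1_def using periodic_scale assms(3) count_scale[OF assms(3,1) \<xi>'(2)]
      defect_scale[OF assms(3,1) \<xi>'(2)] by blast+
  have defZ: "defect p Q\<^sub>1 (z - z') \<le> r" if zz: "z \<in> Z" "z' \<in> Z" for z z'
  proof -
    obtain b b' where b: "b \<in> B\<^sub>1" "b' \<in> B\<^sub>1" "z - z' = y b - y b'" using zz unfolding Z_def by auto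
    have "defect p Q\<^sub>1 (z - z') = defect p Q (b - b')"
      unfolding b(3) Q1(3) by (rule defect_dvd[OF assms(3) yy[OF b(1,2)]])
    then show ?thesis using small b unfolding B\<^sub>1_def by simp
  qed
  \<comment> \<open>800 is \<open>40 * 20\<close>, as the level-set bound at \<open>20 * r\<close>
    requires.\<close>
  have "800 * r \<le> count_mod p Q" "int (count_mod p Q) + 800 * int r \<le> p"
    using sz Cr assms(2) by linarith+
  then have "2 * count_mod p {t. defect p Q\<^sub>1 t \<le> 20 * r} \<le> 5 * (20 * r) + 2"
    using assms(6) by (intro count_defect_le[OF assms(1) Q1(1)]) (simp_all add: Q1(2))
  then have level: "2 * count_mod p {t. defect p Q\<^sub>1 t \<le> 20 * r} \<le> 100 * r + 2" by simp
  obtain h m where hm: "h > 0" "m > 0" "M = h * m" "9 * int r \<le> 10 * m" "2 * m \<le> 3 * int r"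
    "\<forall>x. 0 \<le> x \<and> x \<le> m \<longrightarrow> defect p Q\<^sub>1 (h * x) \<le> 2 * r"
    using progression_structure[OF assms(1) Q1(1) assms(6) _ ZM Z0(1,2,3) _ _ defZ level] fB1 cZ cB s assms(5)
    unfolding Z_def by auto
  have hM: "m \<le> M" "h \<le> M" using hm(1-3) by simp_all
  \<comment> \<open>In the original coordinates the progression has difference
    \<open>\<xi>' * h\<close>.\<close>
  have "\<not> p dvd h" using hM Z0(3) hm(1,2) zdvd_not_zless[of h p] by auto
  then have "\<not> p dvd \<xi>' * h" using \<xi>'(2) assms(1) by (simp add: prime_dvd_mult_iff)
  moreover have "defect p Q (\<xi>' * h * m) \<le> r"
    using defZ[OF Z0(2,1)] unfolding hm(3) Q1(3) by (simp add: mult.assoc)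
  moreover have "\<forall>x. 0 \<le> x \<and> x \<le> m \<longrightarrow> defect p Q (\<xi>' * h * x) \<le> 2 * r"
    using hm(6) unfolding Q1(3) by (simp add: mult.assoc)
  moreover have "50 * m < p" using hM Z0(3) by linarith
  ultimately show ?thesis using hm(2,4,5) by blast
qed

lemma three_translates_of_small_set:
  fixes C :: real
  assumes "prime p" "p = int n" "periodic p Q" "B \<subseteq> {0..<p}" "card B = r + 1" "r \<ge> 1"
    and C: "C \<ge> 40 / (1 - cos (pi / 50))" "C \<ge> 303745"
    and sz: "C * real r \<le> real (count_mod p Q)" "C * real r \<le> real n - real (count_mod p Q)"
  shows "\<exists>b\<^sub>1\<in>B. \<exists>b\<^sub>2\<in>B. \<exists>b\<^sub>3\<in>B. count_mod p Q + r \<le> count_mod p (translates Q b\<^sub>1 b\<^sub>2 b\<^sub>3)"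
proof (cases "\<forall>b\<in>B. \<forall>b'\<in>B. defect p Q (b - b') \<le> r")
  case False
  have p: "p > 0" using assms(1) prime_gt_0_int by blast
  obtain b b' where b: "b \<in> B" "b' \<in> B" "r \<le> defect p Q (b - b')" using False by (meson less_imp_le not_le)
  have "count_mod p Q + r \<le> count_mod p (translates Q b b' b')"
    using b(3) count_translates_pair[OF assms(3) p, of b b'] by simp
  then show ?thesis using b(1,2) by blast
next
  case True
  have p: "p > 0" using assms(1) prime_gt_0_int by blast
  have "C \<ge> 800" using C(2) by simp
  with True obtain e m where e: "\<not> p dvd e" and m: "m > 0" "50 * m < p" "9 * int r \<le> 10 * m" "2 * m \<le> 3 * int r"
    and g: "\<And>x. 0 \<le> x \<Longrightarrow> x \<le> m \<Longrightarrow> defect p Q (e * x) \<le> 2 * r" and gm: "defect p Q (e * m) \<le> r"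
    using exists_progression[OF assms(1-6) _ C(1) _ sz] by blast
  have Cr: "303745 * real r \<le> C * real r" using C(2) by (intro mult_right_mono) auto
  have sz': "303745 * r \<le> count_mod p Q" "int (count_mod p Q) + 303745 * int r \<le> p"
    using sz Cr assms(2) by linarith+
  define Q\<^sub>2 where "Q\<^sub>2 = {x. e * x \<in> Q}"
  have Q2: "periodic p Q\<^sub>2" "count_mod p Q\<^sub>2 = count_mod p Q" "\<And>t. defect p Q\<^sub>2 t = defect p Q (e * t)"
    unfolding Q\<^sub>2_def using periodic_scale assms(3) count_scale[OF assms(3,1) e]
      defect_scale[OF assms(3,1) e] by blast+
  have g2: "\<And>x. 0 \<le> x \<Longrightarrow> x \<le> m \<Longrightarrow> defect p Q\<^sub>2 x \<le> 2 * r" "defect p Q\<^sub>2 m \<le> r"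
    using g gm unfolding Q2(3) by blast+
  have "2 * count_mod p {t. defect p Q\<^sub>2 t \<le> 11 * r} \<le> 5 * (11 * r) + 2"
    using sz' assms(6) by (intro count_defect_le[OF assms(1) Q2(1)]) (auto simp: Q2(2))
  then have level: "2 * count_mod p {t. defect p Q\<^sub>2 t \<le> 11 * r} \<le> 55 * r + 2" by simp
  obtain e' where e': "p dvd e * e' - 1" using exists_inverse_mod[OF assms(1) e] by blast
  have fB: "finite B" using assms(4) finite_subset by blast
  obtain b\<^sub>0 where b0: "b\<^sub>0 \<in> B" using assms(5) by fastforce
  \<comment> \<open>Here the exceptional elements return: every \<open>b\<close> in \<open>B\<close>
    has a coordinate \<open>e' * (b - b\<^sub>0)\<close> of defect at most \<open>r\<close>, whether
    or not it lay in the short interval.\<close>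
  have "\<exists>y. \<bar>y\<bar> \<le> 16 * m \<and> p dvd b - (b\<^sub>0 + e * y)" if b: "b \<in> B" for b
  proof -
    have d: "p dvd e * (e' * (b - b\<^sub>0)) - (b - b\<^sub>0)"
      using dvd_mult2[OF e', of "b - b\<^sub>0"] by (simp add: algebra_simps)
    have "defect p Q\<^sub>2 (e' * (b - b\<^sub>0)) \<le> r"
      unfolding Q2(3) defect_dvd[OF assms(3) d] using True b b0 by blast
    then obtain y where y: "\<bar>y\<bar> \<le> 16 * m" "p dvd e' * (b - b\<^sub>0) - y"
      using near_if_small_defect[OF assms(1) Q2(1) assms(6) m(1,3,2) g2 level] by blast
    have "p dvd e * (e' * (b - b\<^sub>0) - y) - (e * (e' * (b - b\<^sub>0)) - (b - b\<^sub>0))"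
      by (rule dvd_diff[OF dvd_mult[OF y(2)] d])
    then show ?thesis using y(1) by (intro exI[of _ y]) (simp add: algebra_simps)
  qed
  then obtain y where y: "\<And>b. b \<in> B \<Longrightarrow> \<bar>y b\<bar> \<le> 16 * m" "\<And>b. b \<in> B \<Longrightarrow> p dvd b - (b\<^sub>0 + e * y b)" by metis
  have inj: "inj_on y B"
  proof (rule inj_onI)
    fix b b' assume b: "b \<in> B" "b' \<in> B" "y b = y b'"
    have "p dvd (b - (b\<^sub>0 + e * y b)) - (b' - (b\<^sub>0 + e * y b'))"
      by (rule dvd_diff[OF y(2)[OF b(1)] y(2)[OF b(2)]])
    then have "p dvd b - b'" using b(3) by simp
    then have "b mod p = b' mod p" by (simp only: mod_eq_dvd_iff)
    moreover have "b' mod p = b'" "b mod p = b" using b assms(4) by auto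
    ultimately show "b = b'" by metis
  qed
  define l where "l = Min (y ` B)"
  define M where "M = Max (y ` B) - l"
  define Y where "Y = (\<lambda>z. z - l) ` y ` B"
  have fin: "finite (y ` B)" "y ` B \<noteq> {}" using fB b0 by auto
  obtain b' b'' where ends: "b' \<in> B" "l = y b'" "b'' \<in> B" "Max (y ` B) = y b''"
    using Min_in[OF fin] Max_in[OF fin] unfolding l_def by auto
  have Y0: "0 \<in> Y" "M \<in> Y" "M \<le> 32 * m"
    using ends y(1)[OF ends(1)] y(1)[OF ends(3)] unfolding Y_def M_def by auto
  have YM: "Y \<subseteq> {0..M}" unfolding Y_def M_def l_def using fin by auto
  have cY: "card Y = r + 1" unfolding Y_def using inj assms(5) by (simp add: card_image)
  have Mpos: "M > 0"
  proof (rule ccontr)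
    assume "\<not> M > 0"
    then have "Y \<subseteq> {0}" using YM by auto
    then have "card Y \<le> 1" using card_mono[of "{0}" Y] by simp
    then show False using cY assms(6) by simp
  qed
  have Mr: "M \<le> 48 * int r" using Y0(3) m(4) by linarith
  \<comment> \<open>As \<open>7 * M \<le> 224 * m\<close>, defects on the window are at most
    \<open>226 * r\<close>. With \<open>M \<le> 48 * r\<close> the complement has to exceed
    \<open>4 * 7 * 226 * 48 = 303744\<close> times \<open>r\<close>, whence 303745.\<close>
  obtain z where z: "4 * card (Q\<^sub>2 \<inter> {z..<z + int (nat (7 * M))}) \<le> r"
  proof -
    have "defect p Q\<^sub>2 x \<le> 226 * r" if "0 \<le> x" "x < int (nat (7 * M))" for x
      using defect_le_on_interval[OF Q2(1) p m(1) g2, of x 224] that Y0(3) Mpos by simp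
    moreover have "4 * int (nat (7 * M)) * int (226 * r) < (p - int (count_mod p Q\<^sub>2)) * int r"
    proof -
      have "4 * int (nat (7 * M)) * int (226 * r) = (6328 * M) * int r" using Mpos by simp
      also have "\<dots> < (p - int (count_mod p Q\<^sub>2)) * int r"
        using Mr sz'(2) assms(6) unfolding Q2(2) by (intro mult_strict_right_mono) linarith+
      finally show ?thesis .
    qed
    ultimately show ?thesis using exists_sparse_window[OF Q2(1) p] that by blast
  qed
  have "\<exists>b\<in>Y. count_mod p Q\<^sub>2 + r \<le> count_mod p (translates Q\<^sub>2 0 M b)"
  proof (rule three_translates_if_sparse[OF Q2(1) p YM Y0(1,2) Mpos cY assms(6)])
    show "7 * M \<le> p" using Mr sz'(2) by linarith
    show "4 * card (Q\<^sub>2 \<inter> {z..<z + 7 * M}) \<le> r" using z Mpos by simp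
    show "2 * r \<le> count_mod p Q\<^sub>2" using sz'(1) unfolding Q2(2) by linarith
  qed
  then obtain x where x: "x \<in> Y" "count_mod p Q + r \<le> count_mod p (translates Q\<^sub>2 0 M x)" unfolding Q2(2) by blast
  have lift: "\<exists>b\<in>B. p dvd b - ((b\<^sub>0 + e * l) + e * x)" if x: "x \<in> Y" for x
  proof -
    obtain b where b: "b \<in> B" "x = y b - l" using x unfolding Y_def by blast
    have "b\<^sub>0 + e * l + e * x = b\<^sub>0 + e * y b" unfolding b(2) by (simp add: algebra_simps)
    then show ?thesis using y(2)[OF b(1)] b(1) by metis
  qed
  obtain b\<^sub>1 b\<^sub>2 b\<^sub>3 where b: "b\<^sub>1 \<in> B" "b\<^sub>2 \<in> B" "b\<^sub>3 \<in> B"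
    "p dvd b\<^sub>1 - ((b\<^sub>0 + e * l) + e * 0)" "p dvd b\<^sub>2 - ((b\<^sub>0 + e * l) + e * M)" "p dvd b\<^sub>3 - ((b\<^sub>0 + e * l) + e * x)"
    using lift[OF Y0(1)] lift[OF Y0(2)] lift[OF x(1)] by blast
  have "count_mod p (translates Q\<^sub>2 0 M x) = count_mod p (translates Q b\<^sub>1 b\<^sub>2 b\<^sub>3)"
    unfolding Q\<^sub>2_def by (rule count_translates_affine[OF assms(1,3) e b(4-6)])
  then show ?thesis using x(2) b(1-3) by auto
qed

section \<open>Return to the group and choice of the constant\<close>

lemma count_translates_le_card_set_mult:
  assumes "p > 0" "A \<subseteq> {0..<int p}"
  shows "count_mod (int p) (translates {x. x mod int p \<in> A} b\<^sub>1 b\<^sub>2 b\<^sub>3)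
    \<le> card (A <#>\<^bsub>integer_mod_group p\<^esub> {b\<^sub>1, b\<^sub>2, b\<^sub>3})"
proof -
  have fin: "finite A" using assms(2) finite_subset by blast
  have eq: "A <#>\<^bsub>integer_mod_group p\<^esub> {b\<^sub>1, b\<^sub>2, b\<^sub>3} = (\<lambda>(a, b). (a + b) mod int p) ` (A \<times> {b\<^sub>1, b\<^sub>2, b\<^sub>3})"
    unfolding set_mult_def by auto
  have "translates {x. x mod int p \<in> A} b\<^sub>1 b\<^sub>2 b\<^sub>3 \<inter> {0..<int p} \<subseteq> A <#>\<^bsub>integer_mod_group p\<^esub> {b\<^sub>1, b\<^sub>2, b\<^sub>3}"
  proof
    fix x assume x: "x \<in> translates {x. x mod int p \<in> A} b\<^sub>1 b\<^sub>2 b\<^sub>3 \<inter> {0..<int p}"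
    then obtain b where b: "b \<in> {b\<^sub>1, b\<^sub>2, b\<^sub>3}" "(x - b) mod int p \<in> A" unfolding translates_def by blast
    have "x = ((x - b) mod int p + b) mod int p" using x by (simp add: mod_add_left_eq)
    then show "x \<in> A <#>\<^bsub>integer_mod_group p\<^esub> {b\<^sub>1, b\<^sub>2, b\<^sub>3}"
      unfolding eq using b by (intro image_eqI[of _ _ "((x - b) mod int p, b)"]) auto
  qed
  then show ?thesis unfolding count_mod_def using fin by (intro card_mono) (auto simp: eq)
qed

theorem theorem5:
  fixes \<beta> :: real
  assumes "\<beta> > 0"
  shows "\<exists>\<alpha>::real. \<alpha> > 0 \<and>
    (\<forall>(p::nat) (A::int set) (B::int set).
      prime p \<longrightarrow>
      A \<subseteq> carrier (integer_mod_group p) \<longrightarrow> B \<subseteq> carrier (integer_mod_group p) \<longrightarrow>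
      A \<noteq> {} \<longrightarrow> B \<noteq> {} \<longrightarrow>
      real (card B) \<le> \<alpha> * real (card A) \<longrightarrow>
      real (card A) + real (card B) \<le> (1 - \<beta>) * real p \<longrightarrow>
      (\<exists>b\<^sub>1\<in>B. \<exists>b\<^sub>2\<in>B. \<exists>b\<^sub>3\<in>B.
        real (card (A <#>\<^bsub>integer_mod_group p\<^esub> {b\<^sub>1, b\<^sub>2, b\<^sub>3}))
          \<ge> real (card A) + real (card B) - 1))"
proof -
  \<comment> \<open>303745 serves the cut, the cosine quotient the concentration of
    \<open>B\<close>.\<close>
  define C :: real where "C = max 303745 (40 / (1 - cos (pi / 50)))"
  have C: "C > 0" "C \<ge> 40 / (1 - cos (pi / 50))" "C \<ge> 303745" unfolding C_def by auto
  show ?thesis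
  proof (intro exI[of _ "min 1 \<beta> / C"] conjI allI impI)
    show "0 < min 1 \<beta> / C" using C(1) assms by simp
  next
    fix p :: nat and A B :: "int set"
    assume p: "prime p" and A: "A \<subseteq> carrier (integer_mod_group p)" "A \<noteq> {}"
      and B: "B \<subseteq> carrier (integer_mod_group p)" "B \<noteq> {}"
      and small: "real (card B) \<le> min 1 \<beta> / C * real (card A)"
      and sum: "real (card A) + real (card B) \<le> (1 - \<beta>) * real p"
    have p0: "p > 0" using p prime_gt_0_nat by blast
    have P: "prime (int p)" using p by simp
    have A': "A \<subseteq> {0..<int p}" and B': "B \<subseteq> {0..<int p}"
      using A B p0 by (auto simp: carrier_integer_mod_group)
    define Q where "Q = {x. x mod int p \<in> A}"
    have Q: "periodic (int p) Q" unfolding Q_def by (rule periodic_residues)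
    have "Q \<inter> {0..<int p} = A" using A' unfolding Q_def by auto
    then have cQ: "count_mod (int p) Q = card A" unfolding count_mod_def by simp
    have fin: "finite B" using B' finite_subset by blast
    define r where "r = card B - 1"
    have cB: "card B = r + 1" using B(2) fin unfolding r_def by (simp add: card_gt_0_iff Suc_leI)
    have "\<exists>b\<^sub>1\<in>B. \<exists>b\<^sub>2\<in>B. \<exists>b\<^sub>3\<in>B. count_mod (int p) Q + r \<le> count_mod (int p) (translates Q b\<^sub>1 b\<^sub>2 b\<^sub>3)"
    proof (cases "r = 0")
      case True
      obtain b where "b \<in> B" using B(2) by blast
      moreover have "count_mod (int p) Q + r \<le> count_mod (int p) (translates Q b b b)"
        using True count_translates_pair[OF Q, of b b] p0 by simp
      ultimately show ?thesis by blast
    next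
      case False
      \<comment> \<open>The factor \<open>min 1 \<beta>\<close> serves twice: bounded by 1 it gives
        \<open>C * r \<le> card A\<close>; bounded by \<open>\<beta>\<close> it gives
        \<open>C * r \<le> \<beta> * p\<close>, which is at most the size of the complement of
        \<open>A\<close>.\<close>
      have m: "C * real r \<le> min 1 \<beta> * real (card A)"
      proof -
        have "C * real r \<le> C * real (card B)" using cB C(1) by simp
        also have "\<dots> \<le> C * (min 1 \<beta> / C * real (card A))" using small C(1) by (intro mult_left_mono) auto
        finally show ?thesis using C(1) by simp
      qed
      have "min 1 \<beta> * real (card A) \<le> 1 * real (card A)" by (intro mult_right_mono) auto
      then have s1: "C * real r \<le> real (card A)" using m by linarith
      have "0 < \<beta> * real p" using assms p0 by simp
      then have "real (card A) \<le> real p" using sum by (simp add: algebra_simps)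
      then have "min 1 \<beta> * real (card A) \<le> \<beta> * real p" using assms by (intro mult_mono) auto
      then have s2: "C * real r \<le> real p - real (card A)" using m sum by (simp add: algebra_simps)
      show ?thesis
        using False s1 s2 by (intro three_translates_of_small_set[OF P refl Q B' cB _ C(2,3)]) (auto simp: cQ)
    qed
    then obtain b\<^sub>1 b\<^sub>2 b\<^sub>3 where b: "b\<^sub>1 \<in> B" "b\<^sub>2 \<in> B" "b\<^sub>3 \<in> B"
      "count_mod (int p) Q + r \<le> count_mod (int p) (translates Q b\<^sub>1 b\<^sub>2 b\<^sub>3)" by blast
    have "card A + r \<le> card (A <#>\<^bsub>integer_mod_group p\<^esub> {b\<^sub>1, b\<^sub>2, b\<^sub>3})"
      using b(4) count_translates_le_card_set_mult[OF p0 A', of b\<^sub>1 b\<^sub>2 b\<^sub>3] unfolding Q_def[symmetric] cQ by simp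
    then have "real (card (A <#>\<^bsub>integer_mod_group p\<^esub> {b\<^sub>1, b\<^sub>2, b\<^sub>3})) \<ge> real (card A) + real (card B) - 1"
      unfolding cB by simp
    then show "\<exists>b\<^sub>1\<in>B. \<exists>b\<^sub>2\<in>B. \<exists>b\<^sub>3\<in>B.
        real (card (A <#>\<^bsub>integer_mod_group p\<^esub> {b\<^sub>1, b\<^sub>2, b\<^sub>3})) \<ge> real (card A) + real (card B) - 1"
      using b(1-3) by blast
  qed
qed

end
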